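(* Let $p$ be a prime with $4 \mid (p+1)$. Let $X_{2,i}$, $i \in \mathbb{Z}_{>0}$, be independent commuting indeterminates over $\mathbb{F}_p$. Construct $\mathbb{F}_{p^2}$ as $\mathbb{F}_p[X_{2,1}]/(X_{2,1}^2+1)$, with the corresponding Steinitz numbering, and let $a \in \mathbb{F}_{p^2}$ be the element without a square root in $\mathbb{F}_{p^2}$ returned by the algorithm NonRthPower (defined in the context) with inputs $\mathbb{F}_{p^2}$ and $2$. Define $$f_{2,1} := X_{2,1}^2 + 1,$$ $$f_{2,2} := X_{2,2}^2 - a,$$ $$f_{2,i} := X_{2,i}^2 - X_{2,i-1} \quad \text{for } i \geq 3,$$ where in $f_{2,2}$ the element $a$ is written as its unique representative in $\mathbb{F}_p[X_{2,1}]$ of degree $<2$ in $X_{2,1}$, so that these are polynomials in $\mathbb{F}_p[X_{2,i} \mid i \in \mathbb{Z}_{>0}]$. Then for each $l \in \mathbb{Z}_{>0}$ the sequence $((X_{2,i}, f_{2,i}),\ 1 \leq i \leq l)$ defines a tower of field extensions over $\mathbb{F}_p$ in which each step has degree $2$.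
   Context: $\mathbb{F}_p = \mathbb{Z}/p\mathbb{Z}$ denotes the field with $p$ elements. Since $4 \mid (p+1)$, the element $-1$ has no square root in $\mathbb{F}_p$, so $X_{2,1}^2+1$ is irreducible over $\mathbb{F}_p$. Tower of field extensions: let $F$ be a field and $X_1,\ldots,X_l$ independent commuting indeterminates over $F$. For $i=1,\ldots,l$ let $f_i \in F[X_1,\ldots,X_{i-1}][X_i]$ be monic in the variable $X_i$. The sequence $((X_i,f_i),\ i=1,\ldots,l)$ defines a tower of (algebraic) field extensions over $F$ if for each $i=1,\ldots,l$ the residue class of $f_i$ in $F[X_1,\ldots,X_{i-1}][X_i]/(f_1,\ldots,f_{i-1}) = (F[X_1,\ldots,X_{i-1}]/(f_1,\ldots,f_{i-1}))[X_i]$ is irreducible. In that case one has a chain of fields $F = F_0 \leq F_1 \leq \cdots \leq F_l$ with $F_i = F[X_1,\ldots,X_i]/(f_1,\ldots,f_i)$, and the degree $[F_i:F_{i-1}]$ is the degree of $f_i$ in $X_i$. StandardAffineShift: for integers $q>0$ and $i$, $\mathrm{StandardAffineShift}(q,i)$ is the integer $(m i + c) \bmod q$ (in the range $0,\ldots,q-1$), where $m$ is the largest integer with $m \leq \frac{4}{5}q$ and $\gcd(m,q)=1$, and $c$ is the largest integer $\leq \frac{2}{3}q$. Steinitz numbering of $\mathbb{F}_{p^2} = \mathbb{F}_p[X_{2,1}]/(X_{2,1}^2+1)$: the residue class of $c_0 + c_1 X_{2,1}$, where $c_j = k_j + p\mathbb{Z}$ with $0 \leq k_j < p$, has Steinitz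 number $k_0 + k_1 p$. This is a bijection from $\mathbb{F}_{p^2}$ to $\{0,1,\ldots,p^2-1\}$. Algorithm NonRthPower$(\mathbb{F}_{p^2}, 2)$: start with $i=0$ and $a = 0 \in \mathbb{F}_{p^2}$; while $a = 0$ or $a^{(p^2-1)/2} = 1$, increase $i$ by $1$ and set $a$ to the element of $\mathbb{F}_{p^2}$ with Steinitz number $\mathrm{StandardAffineShift}(p^2,i)$; when the loop ends, return $a$. *)

theory Defs
  imports
    "HOL-Library.Poly_Mapping"
    "HOL-Library.While_Combinator"
    "HOL-Algebra.Algebra"
    "HOL-Algebra.Algebraic_Closure_Type"
    "Berlekamp_Zassenhaus.Finite_Field"
begin

section \<open>Towers of field extensions\<close>

text \<open>Polynomials in the countably many indeterminates \<open>X_0, X_1, X_2, ...\<close>; a monomial is a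
  finitely supported exponent function. The indeterminate \<open>X_0\<close> is never used.\<close>

type_synonym 'a mpoly = "(nat \<Rightarrow>\<^sub>0 nat) \<Rightarrow>\<^sub>0 'a"

definition Var :: "nat \<Rightarrow> 'a::comm_ring_1 mpoly" where
  "Var i = Poly_Mapping.single (Poly_Mapping.single i 1) 1"

definition Const :: "'a::comm_ring_1 \<Rightarrow> 'a mpoly" where
  "Const c = Poly_Mapping.single 0 c"

definition vars :: "'a::comm_ring_1 mpoly \<Rightarrow> nat set" where
  "vars f = (\<Union>m\<in>Poly_Mapping.keys f. Poly_Mapping.keys m)"

text \<open>The ring \<open>F[X_1, ..., X_n]\<close>.\<close>

definition mpoly_ring :: "nat \<Rightarrow> 'a::comm_ring_1 mpoly ring" where
  "mpoly_ring n = ring_of_type_algebra \<lparr> carrier := {f. vars f \<subseteq> {1..n}} \<rparr>"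

definition tower_ideal :: "(nat \<Rightarrow> 'a::comm_ring_1 mpoly) \<Rightarrow> nat \<Rightarrow> 'a mpoly set" where
  "tower_ideal f n = Idl\<^bsub>mpoly_ring n\<^esub> (f ` {1..n})"

text \<open>The ring \<open>F_n = F[X_1, ..., X_n] / (f_1, ..., f_n)\<close>; its elements are cosets.\<close>

definition tower_ring :: "(nat \<Rightarrow> 'a::comm_ring_1 mpoly) \<Rightarrow> nat \<Rightarrow> 'a mpoly set ring" where
  "tower_ring f n = mpoly_ring n Quot tower_ideal f n"

definition residue_class :: "(nat \<Rightarrow> 'a::comm_ring_1 mpoly) \<Rightarrow> nat \<Rightarrow> 'a mpoly \<Rightarrow> 'a mpoly set" where
  "residue_class f n g = tower_ideal f n +>\<^bsub>mpoly_ring n\<^esub> g"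

text \<open>\<open>g\<close> is \<open>h\<close> regarded as an element of \<open>F[X_1, ..., X_{i-1}][X_i]\<close>. There is at most one
  such \<open>g\<close>, because \<open>X_i\<close> is transcendental over \<open>F[X_1, ..., X_{i-1}]\<close>.\<close>

definition univariate_view :: "nat \<Rightarrow> 'a::comm_ring_1 mpoly \<Rightarrow> 'a mpoly poly \<Rightarrow> bool" where
  "univariate_view i h g \<longleftrightarrow>
     (\<forall>k. Polynomial.coeff g k \<in> carrier (mpoly_ring (i - 1))) \<and> poly g (Var i) = h"

text \<open>The residue class of \<open>g\<close> in \<open>(F[X_1, ..., X_n] / (f_1, ..., f_n))[X_{n+1}]\<close>. Polynomials over
  a ring record are coefficient lists starting with the leading coefficient.\<close>

definition reduce_coeffs ::
    "(nat \<Rightarrow> 'a::comm_ring_1 mpoly) \<Rightarrow> nat \<Rightarrow> 'a mpoly poly \<Rightarrow> 'a mpoly set list" where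
  "reduce_coeffs f n g = ring.normalize (tower_ring f n) (map (residue_class f n) (rev (coeffs g)))"

definition field_tower :: "(nat \<Rightarrow> 'a::field mpoly) \<Rightarrow> nat \<Rightarrow> bool" where
  "field_tower f l \<longleftrightarrow>
     (\<forall>i\<in>{1..l}. \<exists>g. univariate_view i (f i) g \<and> Polynomial.lead_coeff g = 1 \<and>
        ring_irreducible\<^bsub>poly_ring (tower_ring f (i - 1))\<^esub> (reduce_coeffs f (i - 1) g))"

text \<open>The natural map \<open>F_{i-1} \<rightarrow> F_i\<close>: it sends the coset \<open>g + (f_1, ..., f_{i-1})\<close> to
  \<open>g + (f_1, ..., f_i)\<close>.\<close>

definition tower_map :: "(nat \<Rightarrow> 'a::comm_ring_1 mpoly) \<Rightarrow> nat \<Rightarrow> 'a mpoly set \<Rightarrow> 'a mpoly set" where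
  "tower_map f i A = tower_ideal f i <+>\<^bsub>mpoly_ring i\<^esub> A"

text \<open>\<open>F_{i-1}\<close> and \<open>F_i\<close> are fields and \<open>[F_i : F_{i-1}] = d\<close>.\<close>

definition tower_step_degree :: "(nat \<Rightarrow> 'a::field mpoly) \<Rightarrow> nat \<Rightarrow> nat \<Rightarrow> bool" where
  "tower_step_degree f i d \<longleftrightarrow>
     Ring.field (tower_ring f (i - 1)) \<and> Ring.field (tower_ring f i) \<and>
     tower_map f i \<in> Ring.ring_hom (tower_ring f (i - 1)) (tower_ring f i) \<and>
     ring.dimension (tower_ring f i) d
       (tower_map f i ` carrier (tower_ring f (i - 1))) (carrier (tower_ring f i))"


section \<open>The algorithm NonRthPower over \<open>F_{p^2}\<close>\<close>

definition standard_affine_shift :: "int \<Rightarrow> int \<Rightarrow> int" where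
  "standard_affine_shift q i =
     (let m = (GREATEST m::int. rat_of_int m \<le> 4 / 5 * rat_of_int q \<and> gcd m q = 1);
          c = \<lfloor>2 / 3 * rat_of_int q\<rfloor>
      in (m * i + c) mod q)"

text \<open>The field with \<open>p\<close> elements is \<open>'p mod_ring\<close>, where \<open>p = CARD('p)\<close>. In the next definition only
  the value at \<open>1\<close> matters.\<close>

abbreviation gauss_seq :: "nat \<Rightarrow> 'p::prime_card mod_ring mpoly" where
  "gauss_seq \<equiv> (\<lambda>_. Var 1 ^ 2 + 1)"

definition Fp2 :: "'p::prime_card mod_ring mpoly set ring" where
  "Fp2 = tower_ring gauss_seq 1"

definition has_steinitz_number :: "'p::prime_card mod_ring mpoly set \<Rightarrow> int \<Rightarrow> bool" where
  "has_steinitz_number x n \<longleftrightarrow>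
     (\<exists>k0 k1. 0 \<le> k0 \<and> k0 < int CARD('p) \<and> 0 \<le> k1 \<and> k1 < int CARD('p) \<and>
        x = residue_class gauss_seq 1 (Const (of_int k0) + Const (of_int k1) * Var 1) \<and>
        n = k0 + k1 * int CARD('p))"

definition steinitz_elem :: "int \<Rightarrow> 'p::prime_card mod_ring mpoly set" where
  "steinitz_elem n = (THE x. has_steinitz_number x n)"

text \<open>\<open>NonRthPower(F_{p^2}, r)\<close>; the result is \<^term>\<open>None\<close> iff the loop does not terminate.\<close>

definition non_rth_power :: "nat \<Rightarrow> 'p::prime_card mod_ring mpoly set option" where
  "non_rth_power r =
     map_option snd
       (while_option
          (\<lambda>(i, a). a = \<zero>\<^bsub>Fp2\<^esub> \<or> a [^]\<^bsub>Fp2\<^esub> ((CARD('p) ^ 2 - 1) div r) = \<one>\<^bsub>Fp2\<^esub>)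
          (\<lambda>(i, a). (i + 1, steinitz_elem (standard_affine_shift (int CARD('p) ^ 2) (i + 1))))
          (0 :: int, \<zero>\<^bsub>Fp2 :: 'p mod_ring mpoly set ring\<^esub>))"

text \<open>The representative in \<open>F_p[X_1]\<close> of degree less than 2.\<close>

definition Fp2_rep :: "'p::prime_card mod_ring mpoly set \<Rightarrow> 'p mod_ring mpoly" where
  "Fp2_rep a = (THE g. g \<in> carrier (mpoly_ring 1) \<and>
     (\<forall>m\<in>Poly_Mapping.keys g. Poly_Mapping.lookup m 1 < 2) \<and> residue_class gauss_seq 1 g = a)"


section \<open>The polynomials \<open>f_{2,i}\<close>\<close>

text \<open>The indeterminate \<open>X_{2,i}\<close> is \<^term>\<open>Var i\<close>. The value at \<open>0\<close> is irrelevant.\<close>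

definition f2 :: "'p::prime_card mod_ring mpoly set \<Rightarrow> nat \<Rightarrow> 'p mod_ring mpoly" where
  "f2 a i = (if i \<le> 1 then Var 1 ^ 2 + 1
             else if i = 2 then Var 2 ^ 2 - Fp2_rep a
             else Var i ^ 2 - Var (i - 1))"

end

theory Submission
  imports Defs
begin

text \<open>
  Adjoining a square root of a non-square to a field gives a quadratic extension, so each step of
  the tower amounts to the statement that the element whose root is adjoined is not a square in
  the field reached so far.
  For the first step this is the fact that \<open>-1\<close> is not a square modulo \<open>p\<close>, and for the second
  it is what the loop condition of NonRthPower guarantees, by Fermat's theorem in the field with
  \<open>p^2\<close> elements. All later steps follow from one observation (\<open>root_nonsquare\<close>): let \<open>-1 = j^2\<close>
  in a field \<open>K\<close>, and let \<open>\<xi>^2\<close> be a non-square of \<open>K\<close>. If \<open>\<xi> = (u + v \<xi>)^2\<close> with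
  \<open>u, v \<in> K\<close>, then comparing coefficients gives \<open>u^2 + v^2 \<xi>^2 = 0\<close> and \<open>2 u v = 1\<close>, whence
  \<open>\<xi>^2 = (j u / v)^2\<close> is a square after all. So \<open>\<xi>\<close> is a non-square in \<open>K(\<xi>)\<close>, and the
  construction can be repeated with its square root.

  To work with elements instead of cosets, roots \<open>x_i\<close> of the polynomials are chosen in an
  algebraic closure. The lemma \<open>tower_ideal_eq\<close> says that the ideal \<open>(f_1, ..., f_n)\<close> is the
  kernel of evaluation at \<open>(x_1, ..., x_n)\<close>; consequently the ring \<open>F_n\<close> is a copy of the subring
  generated by the \<open>x_i\<close>, and irreducibility and degrees can be read off there. This
  is done for all towers of quadratic polynomials \<open>X_i^2 - c_i\<close> in the locale \<open>quadratic_tower\<close>,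
  whose only arithmetical hypothesis is that \<open>x_i\<close> does not lie in the ring generated by its
  predecessors.

  The loop terminates because the affine shift runs through all residues modulo \<open>p^2\<close>, so every
  element of the field is tried eventually, and because \<open>y^((p^2 - 1) / 2) - 1\<close> has too few roots
  to vanish at every nonzero element.
\<close>

section \<open>Polynomials in several indeterminates\<close>

lemma poly_mapping_induct_single_add [case_names zero single add]:
  fixes f :: "'k \<Rightarrow>\<^sub>0 'v::comm_monoid_add"
  assumes "Q 0" and "\<And>k v. Q (Poly_Mapping.single k v)"
    and "\<And>g h. Q g \<Longrightarrow> Q h \<Longrightarrow> Q (g + h)"
  shows "Q f"
proof (induction f rule: update_induct)
  case const
  show ?case by fact
next
  case (update f a b)
  have "Poly_Mapping.update a b f = f + Poly_Mapping.single a b"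
  proof (rule poly_mapping_eqI)
    fix k
    have "Poly_Mapping.lookup f a = 0"
      using update.hyps(1) by (simp add: in_keys_iff)
    then show "Poly_Mapping.lookup (Poly_Mapping.update a b f) k
        = Poly_Mapping.lookup (f + Poly_Mapping.single a b) k"
      by (auto simp: lookup_update lookup_add lookup_single)
  qed
  then show ?case
    using update assms by simp
qed

lemma single_eq_Const_mult:
  "Poly_Mapping.single m c = Const c * Poly_Mapping.single m (1 :: 'a::comm_ring_1)"
  by (simp add: Const_def mult_single)

lemma single_single_eq_Var_power:
  "Poly_Mapping.single (Poly_Mapping.single i k) 1 = (Var i ^ k :: 'a::comm_ring_1 mpoly)"
proof (induction k)
  case (Suc k)
  have "(Poly_Mapping.single (Poly_Mapping.single i (Suc k)) 1 :: 'a mpoly)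
      = Poly_Mapping.single (Poly_Mapping.single i 1 + Poly_Mapping.single i k) (1 * 1)"
    by (simp flip: single_add)
  also have "\<dots> = Var i * Var i ^ k"
    unfolding mult_single[symmetric] Var_def[symmetric] Suc ..
  finally show ?case
    by simp
qed simp

lemma vars_0 [simp]: "vars 0 = {}"
  and vars_1 [simp]: "vars 1 = {}"
  and vars_Const [simp]: "vars (Const c) = {}"
  and vars_Var [simp]: "vars (Var i :: 'a::comm_ring_1 mpoly) = {i}"
  by (simp_all add: vars_def Const_def Var_def)

lemma vars_uminus [simp]: "vars (- f) = vars f"
proof -
  have "Poly_Mapping.keys (- f) = Poly_Mapping.keys f"
    by (auto simp: in_keys_iff)
  then show ?thesis
    by (simp only: vars_def)
qed

lemma vars_add: "vars (f + g) \<subseteq> vars f \<union> vars g"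
  using Poly_Mapping.keys_add[of f g] by (auto simp: vars_def)

lemma vars_mult: "vars (f * g) \<subseteq> vars f \<union> vars g"
proof
  fix i assume "i \<in> vars (f * g)"
  then obtain m where "m \<in> Poly_Mapping.keys (f * g)" "i \<in> Poly_Mapping.keys m"
    by (auto simp: vars_def)
  then obtain m1 m2 where "m = m1 + m2" "m1 \<in> Poly_Mapping.keys f" "m2 \<in> Poly_Mapping.keys g"
    using keys_mult[of f g] by blast
  then show "i \<in> vars f \<union> vars g"
    using \<open>i \<in> Poly_Mapping.keys m\<close> Poly_Mapping.keys_add[of m1 m2] by (auto simp: vars_def)
qed

lemma vars_add_subset: "vars f \<subseteq> A \<Longrightarrow> vars g \<subseteq> A \<Longrightarrow> vars (f + g) \<subseteq> A"
  using vars_add[of f g] by (meson Un_least subset_trans)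

lemma vars_mult_subset: "vars f \<subseteq> A \<Longrightarrow> vars g \<subseteq> A \<Longrightarrow> vars (f * g) \<subseteq> A"
  using vars_mult[of f g] by (meson Un_least subset_trans)

lemma vars_diff_subset: "vars f \<subseteq> A \<Longrightarrow> vars g \<subseteq> A \<Longrightarrow> vars (f - g) \<subseteq> A"
  using vars_add_subset[of f A "- g"] by simp

text \<open>
  The ring of polynomials in the indeterminates from \<open>A\<close> is generated by constants and
  indeterminates. The induction steps carry the bound on the variables, which is needed for
  statements about \<open>F[X_1, ..., X_n]\<close> such as \<open>quadratic_division\<close>.
\<close>

lemma mpoly_induct [consumes 1, case_names Const Var add mult]:
  fixes h :: "'a::comm_ring_1 mpoly"
  assumes "vars h \<subseteq> A"
    and Const: "\<And>c. Q (Const c)" and Var: "\<And>i. i \<in> A \<Longrightarrow> Q (Var i)"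
    and add: "\<And>f g. vars f \<subseteq> A \<Longrightarrow> vars g \<subseteq> A \<Longrightarrow> Q f \<Longrightarrow> Q g \<Longrightarrow> Q (f + g)"
    and mult: "\<And>f g. vars f \<subseteq> A \<Longrightarrow> vars g \<subseteq> A \<Longrightarrow> Q f \<Longrightarrow> Q g \<Longrightarrow> Q (f * g)"
  shows "Q h"
proof -
  have one: "Q 1"
    using Const[of 1] by (simp add: Const_def)
  have power: "vars (Var i ^ k :: 'a mpoly) \<subseteq> A \<and> Q (Var i ^ k)" if "i \<in> A" for i k
  proof (induction k)
    case (Suc k)
    then show ?case
      using that vars_mult[of "Var i" "Var i ^ k :: 'a mpoly"]
      by (auto intro!: mult Var)
  qed (simp add: one)
  have monom: "vars (Poly_Mapping.single m 1 :: 'a mpoly) \<subseteq> A \<and> Q (Poly_Mapping.single m 1)"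
    if "Poly_Mapping.keys m \<subseteq> A" for m
    using that
  proof (induction m rule: update_induct)
    case const
    then show ?case using one by simp
  next
    case (update m i k)
    have "Poly_Mapping.update i k m = Poly_Mapping.single i k + m"
      using update.hyps(1)
      by (intro poly_mapping_eqI) (auto simp: lookup_update lookup_add lookup_single in_keys_iff)
    then have split: "Poly_Mapping.single (Poly_Mapping.update i k m) 1
        = (Var i ^ k * Poly_Mapping.single m 1 :: 'a mpoly)"
      by (simp add: mult_single flip: single_single_eq_Var_power)
    have "i \<in> A" "Poly_Mapping.keys m \<subseteq> A"
      using update.prems update.hyps(2) by (auto simp: keys_update)
    then show ?case
      using update.IH power[of i k] vars_mult[of "Var i ^ k" "Poly_Mapping.single m (1::'a)"]
      unfolding split by (auto intro!: mult)
  qed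
  have "\<forall>m\<in>S. Poly_Mapping.keys m \<subseteq> A \<Longrightarrow>
      vars (\<Sum>m\<in>S. Poly_Mapping.single m (c m)) \<subseteq> A \<and>
      Q (\<Sum>m\<in>S. Poly_Mapping.single m (c m))" if "finite S" for S and c :: "_ \<Rightarrow> 'a"
    using that
  proof (induction S)
    case empty
    then show ?case using Const[of 0] by (simp add: Const_def)
  next
    case (insert m S)
    have "vars (Poly_Mapping.single m (c m)) \<subseteq> A \<and> Q (Poly_Mapping.single m (c m))"
      using monom[of m] insert.prems vars_mult[of "Const (c m)" "Poly_Mapping.single m (1::'a)"]
      by (subst (1 2) single_eq_Const_mult) (auto intro!: mult Const)
    then show ?case
      using insert vars_add[of "Poly_Mapping.single m (c m)" "\<Sum>m\<in>S. Poly_Mapping.single m (c m)"]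
      by (auto intro!: add)
  qed
  from this[of "Poly_Mapping.keys h" "Poly_Mapping.lookup h"]
  have "Q (\<Sum>m\<in>Poly_Mapping.keys h. Poly_Mapping.single m (Poly_Mapping.lookup h m))"
    using assms(1) by (auto simp: vars_def)
  moreover have "h = (\<Sum>m\<in>Poly_Mapping.keys h. Poly_Mapping.single m (Poly_Mapping.lookup h m))"
    by (intro poly_mapping_eqI)
      (auto simp: lookup_sum lookup_single when_def in_keys_iff sum.delta)
  ultimately show ?thesis
    by simp
qed

lemma mpoly_ring_simps [simp]:
  "carrier (mpoly_ring n :: 'a::comm_ring_1 mpoly ring) = {f. vars f \<subseteq> {1..n}}"
  "monoid.mult (mpoly_ring n) = ((*) :: 'a mpoly \<Rightarrow> _)"
  "ring.add (mpoly_ring n) = ((+) :: 'a mpoly \<Rightarrow> _)"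
  "monoid.one (mpoly_ring n) = (1 :: 'a mpoly)"
  "ring.zero (mpoly_ring n) = (0 :: 'a mpoly)"
  by (simp_all add: mpoly_ring_def ring_of_type_algebra_def)

lemma cring_mpoly_ring: "cring (mpoly_ring n :: 'a::comm_ring_1 mpoly ring)"
proof -
  let ?R = "ring_of_type_algebra :: 'a mpoly ring"
  interpret cring ?R by (rule cring_from_type_algebra)
  have minus: "\<ominus>\<^bsub>?R\<^esub> f = - f" for f :: "'a mpoly"
    by (rule minus_equality) (simp_all add: ring_of_type_algebra_def)
  have "subcring {f. vars f \<subseteq> {1..n}} ?R"
  proof (rule subcringI', rule subringI)
    fix f g :: "'a mpoly" assume "f \<in> {f. vars f \<subseteq> {1..n}}" "g \<in> {f. vars f \<subseteq> {1..n}}"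
    then show "f \<otimes>\<^bsub>?R\<^esub> g \<in> {f. vars f \<subseteq> {1..n}}" "f \<oplus>\<^bsub>?R\<^esub> g \<in> {f. vars f \<subseteq> {1..n}}"
      using vars_mult[of f g] vars_add[of f g] by (auto simp: ring_of_type_algebra_def)
  qed (simp_all add: minus, simp_all add: ring_of_type_algebra_def)
  then show ?thesis
    unfolding mpoly_ring_def using subcring_iff[of "{f. vars f \<subseteq> {1..n}}"]
    by (simp add: ring_of_type_algebra_def)
qed

section \<open>Evaluation in an algebraic closure\<close>

definition eval_monom :: "(nat \<Rightarrow> 'b::comm_ring_1) \<Rightarrow> (nat \<Rightarrow>\<^sub>0 nat) \<Rightarrow> 'b" where
  "eval_monom x m = (\<Prod>i\<in>Poly_Mapping.keys m. x i ^ Poly_Mapping.lookup m i)"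

definition eval_mpoly :: "(nat \<Rightarrow> 'a alg_closure) \<Rightarrow> 'a::field mpoly \<Rightarrow> 'a alg_closure" where
  "eval_mpoly x f = (\<Sum>m\<in>Poly_Mapping.keys f. to_ac (Poly_Mapping.lookup f m) * eval_monom x m)"

lemma eval_monom_superset:
  assumes "finite A" "Poly_Mapping.keys m \<subseteq> A"
  shows "eval_monom x m = (\<Prod>i\<in>A. x i ^ Poly_Mapping.lookup m i)"
  unfolding eval_monom_def using assms by (intro prod.mono_neutral_left) (auto simp: in_keys_iff)

lemma eval_monom_add: "eval_monom x (m + m') = eval_monom x m * eval_monom x m'"
proof -
  let ?A = "Poly_Mapping.keys m \<union> Poly_Mapping.keys m'"
  have "Poly_Mapping.keys (m + m') \<subseteq> ?A"
    by (rule Poly_Mapping.keys_add)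
  then show ?thesis
    by (simp add: eval_monom_superset[of ?A] lookup_add power_add prod.distrib)
qed

lemma eval_superset:
  assumes "finite A" "Poly_Mapping.keys f \<subseteq> A"
  shows "eval_mpoly x f = (\<Sum>m\<in>A. to_ac (Poly_Mapping.lookup f m) * eval_monom x m)"
  unfolding eval_mpoly_def using assms by (intro sum.mono_neutral_left) (auto simp: in_keys_iff)

lemma eval_single [simp]: "eval_mpoly x (Poly_Mapping.single m c) = to_ac c * eval_monom x m"
  by (simp add: eval_superset[of "{m}"])

lemma eval_add [simp]: "eval_mpoly x (f + g) = eval_mpoly x f + eval_mpoly x g"
proof -
  let ?A = "Poly_Mapping.keys f \<union> Poly_Mapping.keys g"
  have "Poly_Mapping.keys (f + g) \<subseteq> ?A"
    by (rule Poly_Mapping.keys_add)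
  then show ?thesis
    by (simp add: eval_superset[of ?A] lookup_add algebra_simps sum.distrib)
qed

lemma eval_0 [simp]: "eval_mpoly x 0 = 0"
  by (simp add: eval_mpoly_def)

lemma eval_mult [simp]: "eval_mpoly x (f * g) = eval_mpoly x f * eval_mpoly x g"
proof (induction f rule: poly_mapping_induct_single_add)
  case (single m c)
  show ?case
    by (induction g rule: poly_mapping_induct_single_add)
      (simp_all add: mult_single eval_monom_add algebra_simps)
qed (simp_all add: distrib_right)

lemma eval_Const [simp]: "eval_mpoly x (Const c) = to_ac c"
  by (simp add: Const_def eval_monom_def)

lemma eval_1 [simp]: "eval_mpoly x 1 = 1"
  by (metis Const_def eval_Const single_one to_ac_1)

lemma eval_Var [simp]: "eval_mpoly x (Var i) = x i"
  by (simp add: Var_def eval_monom_def)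

lemma eval_uminus [simp]: "eval_mpoly x (- f) = - eval_mpoly x f"
proof -
  have "eval_mpoly x f + eval_mpoly x (- f) = 0"
    unfolding eval_add[symmetric] by simp
  then show ?thesis
    by (metis minus_unique)
qed

lemma eval_diff [simp]: "eval_mpoly x (f - g) = eval_mpoly x f - eval_mpoly x g"
proof -
  have "eval_mpoly x (f - g) + eval_mpoly x g = eval_mpoly x f"
    unfolding eval_add[symmetric] by simp
  then show ?thesis
    by (metis add_diff_cancel_right')
qed

lemma eval_power [simp]: "eval_mpoly x (f ^ k) = eval_mpoly x f ^ k"
  by (induction k) simp_all

lemma eval_mpoly_cong:
  assumes "vars h \<subseteq> A" "\<And>i. i \<in> A \<Longrightarrow> x i = y i"
  shows "eval_mpoly x h = eval_mpoly y h"
  using assms(1) by (induction h rule: mpoly_induct) (simp_all add: assms(2))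

section \<open>Quadratic polynomials over a field\<close>

text \<open>
  A factorization into two nonconstant factors would consist of linear ones, and a
  linear polynomial over a field has a root.
\<close>

lemma degree_two_no_root_imp_pirreducible:
  fixes F (structure)
  assumes "Ring.field F" and p: "p \<in> carrier (poly_ring F)" "length p = 3"
    and no_root: "\<And>z. z \<in> carrier F \<Longrightarrow> ring.eval F p z \<noteq> \<zero>"
  shows "pirreducible (carrier F) p"
proof -
  interpret Ring.field F by fact
  have poly: "polynomial (carrier F) q \<longleftrightarrow> q \<in> carrier (poly_ring F)" for q
    by (simp add: univ_poly_def)
  have units: "q \<in> Units (poly_ring F) \<longleftrightarrow> q \<in> carrier (poly_ring F) \<and> q \<noteq> [] \<and> length q \<le> 1" for q
    using univ_poly_units'[OF carrier_is_subfield, of q] by auto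
  have no_root': "length q \<noteq> 2"
    if q: "q \<in> carrier (poly_ring F)" and r: "r \<in> carrier (poly_ring F)"
      and pqr: "p = poly_mult q r" for q r
  proof
    assume "length q = 2"
    then obtain c d where cd: "q = [c, d]"
      by (metis length_0_conv length_Suc_conv numeral_2_eq_2)
    have set: "set q \<subseteq> carrier F" "set r \<subseteq> carrier F"
      using q r by (auto dest: polynomial_incl simp flip: poly)
    have c: "c \<in> carrier F" "c \<noteq> \<zero>" and d: "d \<in> carrier F"
      using q set unfolding poly[symmetric] by (auto simp: cd polynomial_def)
    define z where "z = \<ominus> (inv c \<otimes> d)"
    have inv: "inv c \<in> carrier F" "c \<otimes> inv c = \<one>"
      using c field_Units by auto
    have z: "z \<in> carrier F"
      using inv d by (simp add: z_def)
    have "c \<otimes> z = \<ominus> d"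
      using c(1) d inv by (simp add: z_def r_minus flip: m_assoc)
    then have "eval q z = \<zero>"
      using c d z by (simp add: cd l_neg)
    then have "eval p z = \<zero>"
      using eval_poly_mult[OF set z] eval_in_carrier[OF set(2) z] by (simp add: pqr)
    then show False
      using no_root[OF z] by simp
  qed
  show ?thesis
  proof (rule pirreducibleI[OF carrier_is_subring p(1)])
    show "p \<noteq> []" "p \<notin> Units (poly_ring F)"
      using p(2) by (auto simp: units)
    fix q r assume q: "q \<in> carrier (poly_ring F)" and r: "r \<in> carrier (poly_ring F)"
      and "p = q \<otimes>\<^bsub>poly_ring F\<^esub> r"
    then have pqr: "p = poly_mult q r"
      by (simp add: univ_poly_mult)
    then have prq: "p = poly_mult r q"
      using poly_mult_comm[of q r] q r polynomial_incl by (metis poly)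
    have "length p - 1 = (if q = [] \<or> r = [] then 0 else (length q - 1) + (length r - 1))"
      unfolding pqr using q r by (intro poly_mult_degree_eq[OF carrier_is_subring]) (simp_all add: poly)
    then have "length q + length r = 4 \<and> q \<noteq> [] \<and> r \<noteq> []"
      using p(2) by (cases q; cases r) auto
    moreover have "length q \<noteq> 2" "length r \<noteq> 2"
      using no_root'[OF q r pqr] no_root'[OF r q prq] by auto
    moreover have "length q > 0" "length r > 0"
      using calculation(1) by auto
    ultimately have "length q \<le> 1 \<or> length r \<le> 1"
      by linarith
    then show "q \<in> Units (poly_ring F) \<or> r \<in> Units (poly_ring F)"
      using q r \<open>_ \<and> q \<noteq> [] \<and> r \<noteq> []\<close> by (auto simp: units)
  qed
qed

text \<open>
  The rings below are indexed by intervals \<open>{1..n}\<close>; the default simplification of \<open>1\<close> to \<open>Suc 0\<close>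
  would hide them from the facts stated in this form.
\<close>

declare One_nat_def [simp del]

section \<open>The fields generated by the roots\<close>

definition adjoin :: "(nat \<Rightarrow> 'a::field alg_closure) \<Rightarrow> nat \<Rightarrow> 'a alg_closure set" where
  "adjoin x n = eval_mpoly x ` {h. vars h \<subseteq> {1..n}}"

lemma adjoinI: "vars h \<subseteq> {1..n} \<Longrightarrow> eval_mpoly x h \<in> adjoin x n"
  by (auto simp: adjoin_def)

lemma adjoin_to_ac: "to_ac c \<in> adjoin x n"
  using adjoinI[of "Const c" n x] by simp

lemma adjoin_0: "0 \<in> adjoin x n"
  and adjoin_1: "1 \<in> adjoin x n"
  using adjoinI[of 0 n x] adjoinI[of 1 n x] by simp_all

lemma adjoin_gen: "1 \<le> i \<Longrightarrow> i \<le> n \<Longrightarrow> x i \<in> adjoin x n"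
  using adjoinI[of "Var i" n x] by simp

lemma adjoin_uminus: "y \<in> adjoin x n \<Longrightarrow> - y \<in> adjoin x n"
  by (auto simp: adjoin_def simp flip: eval_uminus)

lemma adjoin_add: "y + z \<in> adjoin x n"
  and adjoin_mult: "y * z \<in> adjoin x n"
  if "y \<in> adjoin x n" "z \<in> adjoin x n"
  using that by (auto simp: adjoin_def vars_add_subset vars_mult_subset
      simp flip: eval_add eval_mult intro!: imageI)

lemma adjoin_diff: "y \<in> adjoin x n \<Longrightarrow> z \<in> adjoin x n \<Longrightarrow> y - z \<in> adjoin x n"
  using adjoin_add[of y x n "- z"] adjoin_uminus[of z x n] by simp

lemma adjoin_mono: "m \<le> n \<Longrightarrow> adjoin x m \<subseteq> adjoin x n"
  unfolding adjoin_def by (intro image_mono Collect_mono) force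

lemma adjoin_zero: "adjoin x 0 = range to_ac"
proof -
  have "eval_mpoly x h \<in> range to_ac" if "vars h \<subseteq> {}" for h
    using that
  proof (induction h rule: mpoly_induct)
    case (add f g)
    then show ?case using rangeI[of to_ac] by (auto simp flip: to_ac_add)
  next
    case (mult f g)
    then show ?case using rangeI[of to_ac] by (auto simp flip: to_ac_mult)
  qed simp_all
  then show ?thesis
    using adjoin_to_ac[of _ x 0] by (auto simp: adjoin_def)
qed

lemma adjoin_cong: "(\<And>i. 1 \<le> i \<Longrightarrow> i \<le> n \<Longrightarrow> x i = y i) \<Longrightarrow> adjoin x n = adjoin y n"
  unfolding adjoin_def by (intro image_cong refl eval_mpoly_cong[of _ "{1..n}"]) auto

section \<open>Towers of quadratic extensions\<close>

text \<open>
  Division with remainder by the monic polynomial \<open>X_i^2 - c\<close> over \<open>F[X_1, ..., X_{i-1}]\<close>. The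
  set of all polynomials of this form is closed under products, since \<open>X_i^2\<close> can be replaced by
  \<open>c\<close>; so induction over the generators of the ring avoids any notion of degree in \<open>X_i\<close>.
\<close>

lemma quadratic_division:
  fixes h c :: "'a::comm_ring_1 mpoly"
  assumes "1 \<le> i" and c: "vars c \<subseteq> {1..i - 1}" and h: "vars h \<subseteq> {1..i}"
  shows "\<exists>u v s. vars u \<subseteq> {1..i - 1} \<and> vars v \<subseteq> {1..i - 1} \<and> vars s \<subseteq> {1..i} \<and>
    h = u + v * Var i + s * (Var i ^ 2 - c)"
  using h
proof (induction h rule: mpoly_induct)
  case (Const a)
  show ?case
    by (rule exI[of _ "Const a"], rule exI[of _ 0], rule exI[of _ 0]) simp
next
  case (Var j)
  then consider "j = i" | "j \<in> {1..i - 1}"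
    by force
  then show ?case
  proof cases
    case 1
    then show ?thesis
      by (intro exI[of _ 0] exI[of _ 1]) simp
  next
    case 2
    then show ?thesis
      by (intro exI[of _ "Var j"] exI[of _ 0]) simp
  qed
next
  case (add g h)
  then obtain u v s u' v' s' where
    "vars u \<subseteq> {1..i - 1}" "vars v \<subseteq> {1..i - 1}" "vars s \<subseteq> {1..i}"
    "vars u' \<subseteq> {1..i - 1}" "vars v' \<subseteq> {1..i - 1}" "vars s' \<subseteq> {1..i}" and
    eq: "g = u + v * Var i + s * (Var i ^ 2 - c)" "h = u' + v' * Var i + s' * (Var i ^ 2 - c)"
    by blast
  then have "vars (u + u') \<subseteq> {1..i - 1}" "vars (v + v') \<subseteq> {1..i - 1}" "vars (s + s') \<subseteq> {1..i}"
    by (simp_all add: vars_add_subset)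
  moreover have "g + h = (u + u') + (v + v') * Var i + (s + s') * (Var i ^ 2 - c)"
    unfolding eq by (simp add: algebra_simps)
  ultimately show ?case
    by blast
next
  case (mult g h)
  have up: "vars p \<subseteq> {1..i}" if "vars p \<subseteq> {1..i - 1}" for p :: "'a mpoly"
    using that by force
  from mult obtain u v s u' v' s' where
    u: "vars u \<subseteq> {1..i - 1}" "vars v \<subseteq> {1..i - 1}" "vars s \<subseteq> {1..i}"
    "vars u' \<subseteq> {1..i - 1}" "vars v' \<subseteq> {1..i - 1}" "vars s' \<subseteq> {1..i}" and
    eq: "g = u + v * Var i + s * (Var i ^ 2 - c)" "h = u' + v' * Var i + s' * (Var i ^ 2 - c)"
    by blast
  \<comment> \<open>All multiples of \<open>X_i^2 - c\<close> together; \<open>v v'\<close> comes from replacing \<open>X_i^2\<close> by \<open>c\<close>.\<close>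
  define w where "w = v * v' + s * h + s' * (u + v * Var i)"
  have "vars (Var i :: 'a mpoly) \<subseteq> {1..i}"
    using \<open>1 \<le> i\<close> by simp
  then have "vars w \<subseteq> {1..i}"
    unfolding w_def using mult.hyps(2) u up by (intro vars_add_subset vars_mult_subset) blast+
  moreover have "vars (u * u' + v * v' * c) \<subseteq> {1..i - 1}" "vars (u * v' + v * u') \<subseteq> {1..i - 1}"
    by ((intro vars_add_subset vars_mult_subset; fact)+)
  moreover have "g * h = (u * u' + v * v' * c) + (u * v' + v * u') * Var i + w * (Var i ^ 2 - c)"
    unfolding w_def eq by (simp add: algebra_simps power2_eq_square)
  ultimately show ?case
    by blast
qed

text \<open>
  The assumption on \<open>x i\<close> states irreducibility without mentioning quotient rings: \<open>X_i^2 - c_i\<close>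
  has the roots \<open>x i\<close> and \<open>- x i\<close>, and it is irreducible over the field generated by the earlier
  roots if and only if these are new elements. The bound \<open>N\<close> leaves \<open>f\<close> and \<open>x\<close> arbitrary beyond
  it, so that a tower can be built one step at a time.
\<close>

locale quadratic_tower =
  fixes x :: "nat \<Rightarrow> 'a::field alg_closure" and f c :: "nat \<Rightarrow> 'a mpoly" and N :: nat
  assumes f_eq: "\<lbrakk>1 \<le> i; i \<le> N\<rbrakk> \<Longrightarrow> f i = Var i ^ 2 - c i"
    and vars_c: "\<lbrakk>1 \<le> i; i \<le> N\<rbrakk> \<Longrightarrow> vars (c i) \<subseteq> {1..i - 1}"
    and root_squared: "\<lbrakk>1 \<le> i; i \<le> N\<rbrakk> \<Longrightarrow> x i ^ 2 = eval_mpoly x (c i)"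
    and root_notin: "\<lbrakk>1 \<le> i; i \<le> N\<rbrakk> \<Longrightarrow> x i \<notin> adjoin x (i - 1)"
begin

lemma eval_f: "\<lbrakk>1 \<le> i; i \<le> N\<rbrakk> \<Longrightarrow> eval_mpoly x (f i) = 0"
  by (simp add: f_eq root_squared)

lemma vars_f:
  assumes "1 \<le> i" "i \<le> N" "i \<le> n"
  shows "vars (f i) \<subseteq> {1..n}"
proof -
  have "vars (c i) \<subseteq> {1..n}"
    using vars_c[OF assms(1,2)] assms(3) by force
  then show ?thesis
    using assms unfolding f_eq[OF assms(1,2)] power2_eq_square
    by (intro vars_diff_subset vars_mult_subset) auto
qed

lemma division:
  assumes "1 \<le> i" "i \<le> N" "vars h \<subseteq> {1..i}"
  obtains u v s where "vars u \<subseteq> {1..i - 1}" "vars v \<subseteq> {1..i - 1}" "vars s \<subseteq> {1..i}"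
    "h = u + v * Var i + s * f i"
  using quadratic_division[OF assms(1) vars_c[OF assms(1,2)] assms(3)] f_eq[OF assms(1,2)] by auto

lemma adjoin_step:
  assumes "1 \<le> i" "i \<le> N"
  shows "adjoin x i = {u + v * x i | u v. u \<in> adjoin x (i - 1) \<and> v \<in> adjoin x (i - 1)}"
proof (intro equalityI subsetI)
  fix y assume "y \<in> adjoin x i"
  then obtain h where h: "vars h \<subseteq> {1..i}" "y = eval_mpoly x h"
    by (auto simp: adjoin_def)
  obtain u v s where "vars u \<subseteq> {1..i - 1}" "vars v \<subseteq> {1..i - 1}"
    "h = u + v * Var i + s * f i"
    using division[OF assms h(1)] by metis
  then have "y = eval_mpoly x u + eval_mpoly x v * x i"
    "eval_mpoly x u \<in> adjoin x (i - 1)" "eval_mpoly x v \<in> adjoin x (i - 1)"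
    using h(2) by (simp_all add: eval_f[OF assms] adjoinI)
  then show "y \<in> {u + v * x i | u v. u \<in> adjoin x (i - 1) \<and> v \<in> adjoin x (i - 1)}"
    by blast
next
  fix y assume "y \<in> {u + v * x i | u v. u \<in> adjoin x (i - 1) \<and> v \<in> adjoin x (i - 1)}"
  then show "y \<in> adjoin x i"
    using adjoin_mono[of "i - 1" i x] adjoin_gen[of i i x] assms(1)
    by (auto intro!: adjoin_add adjoin_mult)
qed

lemma adjoin_inverse: "n \<le> N \<Longrightarrow> y \<in> adjoin x n \<Longrightarrow> inverse y \<in> adjoin x n"
proof (induction n arbitrary: y)
  case 0
  then show ?case
    by (auto simp: adjoin_zero simp flip: to_ac_inverse)
next
  case (Suc n)
  let ?K = "adjoin x n" and ?\<xi> = "x (Suc n)"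
  have step: "adjoin x (Suc n) = {u + v * ?\<xi> | u v. u \<in> ?K \<and> v \<in> ?K}"
    using adjoin_step[of "Suc n"] Suc.prems by simp
  have inv: "inverse z \<in> ?K" if "z \<in> ?K" for z
    using Suc.IH[of z] Suc.prems that by simp
  have notin: "?\<xi> \<notin> ?K" and sq: "?\<xi> ^ 2 \<in> ?K"
    using root_notin[of "Suc n"] root_squared[of "Suc n"] vars_c[of "Suc n"] adjoinI[of "c (Suc n)" n x]
      Suc.prems by auto
  from Suc.prems(2) obtain u v where uv: "y = u + v * ?\<xi>" "u \<in> ?K" "v \<in> ?K"
    unfolding step by blast
  show ?case
  proof (cases "v = 0")
    case True
    then show ?thesis
      using inv[OF uv(2)] uv(1) adjoin_mono[of n "Suc n" x] by auto
  next
    case False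
    \<comment> \<open>Multiply by the conjugate; the norm lies in the smaller field, where it has an inverse.\<close>
    define d where "d = u\<^sup>2 - v\<^sup>2 * ?\<xi>\<^sup>2"
    have d: "d \<in> ?K"
      unfolding d_def power2_eq_square[of u] power2_eq_square[of v]
      using uv sq by (intro adjoin_diff adjoin_mult)
    have ne: "u + v * ?\<xi> \<noteq> 0" "u - v * ?\<xi> \<noteq> 0"
    proof -
      have *: "False" if "w \<in> ?K" "v * ?\<xi> = w" for w
      proof -
        have "?\<xi> = inverse v * w"
          using that False by (auto simp: field_simps)
        then show False
          using notin adjoin_mult[OF inv[OF uv(3)] that(1)] by simp
      qed
      show "u + v * ?\<xi> \<noteq> 0"
        using *[of "- u"] adjoin_uminus[OF uv(2)] by (auto simp: add_eq_0_iff)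
      show "u - v * ?\<xi> \<noteq> 0"
        using *[OF uv(2)] by auto
    qed
    have "d = (u + v * ?\<xi>) * (u - v * ?\<xi>)"
      by (simp add: d_def power2_eq_square algebra_simps)
    then have "inverse y = (u - v * ?\<xi>) * inverse d"
      using ne by (simp add: uv(1))
    then have "inverse y = u * inverse d + (- v * inverse d) * ?\<xi>"
      by (simp add: algebra_simps)
    moreover have "u * inverse d \<in> ?K" "- v * inverse d \<in> ?K"
      using uv inv[OF d] by (auto intro!: adjoin_mult adjoin_uminus)
    ultimately show ?thesis
      unfolding step by blast
  qed
qed

text \<open>
  With \<open>adjoin_step\<close> this says that \<open>1\<close> and \<open>x i\<close> form a basis over the preceding field.
\<close>

lemma adjoin_independent:
  assumes "1 \<le> i" "i \<le> N" and uv: "u \<in> adjoin x (i - 1)" "v \<in> adjoin x (i - 1)"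
    and eq: "u + v * x i = 0"
  shows "u = 0 \<and> v = 0"
proof -
  have "v = 0"
  proof (rule ccontr)
    assume "v \<noteq> 0"
    have "v * x i = - u"
      using eq by (simp add: add_eq_0_iff2)
    then have "x i = inverse v * (- u)"
      using \<open>v \<noteq> 0\<close> by (metis left_inverse mult.assoc mult_1)
    moreover have "inverse v * (- u) \<in> adjoin x (i - 1)"
      using uv assms(2) by (intro adjoin_mult adjoin_inverse adjoin_uminus) auto
    ultimately show False
      using root_notin[OF assms(1,2)] by simp
  qed
  then show ?thesis
    using eq by simp
qed

lemma
  assumes "n \<le> N"
  shows ideal_tower_ideal: "ideal (tower_ideal f n) (mpoly_ring n)"
    and f_in_tower_ideal: "\<lbrakk>1 \<le> i; i \<le> n\<rbrakk> \<Longrightarrow> f i \<in> tower_ideal f n"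
proof -
  interpret cring "mpoly_ring n :: 'a mpoly ring" by (rule cring_mpoly_ring)
  have *: "f ` {1..n} \<subseteq> carrier (mpoly_ring n)"
    using vars_f assms by (intro image_subsetI) simp
  show "ideal (tower_ideal f n) (mpoly_ring n)"
    unfolding tower_ideal_def by (rule genideal_ideal[OF *])
  show "f i \<in> tower_ideal f n" if "1 \<le> i" "i \<le> n"
    unfolding tower_ideal_def using genideal_self[OF *] that by auto
qed

lemma ideal_kernel_eval: "ideal {h. vars h \<subseteq> {1..n} \<and> eval_mpoly x h = 0} (mpoly_ring n)"
proof -
  let ?L = "ring_of_type_algebra :: 'a alg_closure ring"
  have hom: "ring_hom_ring (mpoly_ring n) ?L (eval_mpoly x)"
    by (intro ring_hom_ringI2 ring_hom_memI cring.axioms(1) cring_mpoly_ring cring_from_type_algebra)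
      (simp_all add: ring_of_type_algebra_def)
  have "a_kernel (mpoly_ring n) ?L (eval_mpoly x) = {h. vars h \<subseteq> {1..n} \<and> eval_mpoly x h = 0}"
    by (auto simp: a_kernel_def' ring_of_type_algebra_def)
  then show ?thesis
    using ring_hom_ring.kernel_is_ideal[OF hom] by simp
qed

text \<open>
  Division by \<open>f_n\<close> eliminates \<open>X_n\<close>: if a polynomial vanishes at the roots, then so does its
  remainder \<open>u + v X_n\<close>, and then \<open>u\<close> and \<open>v\<close> do, since \<open>1\<close> and \<open>x n\<close> are linearly independent.
  The ideal stays at the level \<open>m\<close> throughout, so that no comparison of the ideals of
  different rings is needed.
\<close>

lemma kernel_eval_in_tower_ideal:
  assumes "m \<le> N" "n \<le> m" "vars h \<subseteq> {1..n}" "eval_mpoly x h = 0"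
  shows "h \<in> tower_ideal f m"
  using assms(2-)
proof (induction n arbitrary: h)
  interpret ideal "tower_ideal f m" "mpoly_ring m"
    by (rule ideal_tower_ideal[OF assms(1)])
  {
    case 0
    have "h \<in> range Const"
    proof -
      have "vars h \<subseteq> {}"
        using 0 by simp
      then show ?thesis
      proof (induction h rule: mpoly_induct)
        case (add g h)
        then show ?case
          by (auto simp: Const_def simp flip: single_add)
      next
        case (mult g h)
        then show ?case
          by (auto simp: Const_def mult_single)
      qed simp_all
    qed
    then have "h = 0"
      using 0 by (auto simp: Const_def eval_monom_def)
    then show ?case
      using additive_subgroup.zero_closed[OF is_additive_subgroup] by simp
  next
    case (Suc n)
    then have i: "1 \<le> Suc n" "Suc n \<le> N" "Suc n \<le> m"
      using assms(1) by auto
    obtain u v s where uvs: "vars u \<subseteq> {1..n}" "vars v \<subseteq> {1..n}" "vars s \<subseteq> {1..Suc n}"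
      "h = u + v * Var (Suc n) + s * f (Suc n)"
      using division[OF i(1,2) Suc.prems(2)] by auto
    have "eval_mpoly x u + eval_mpoly x v * x (Suc n) = 0"
      using Suc.prems(3) by (simp add: uvs eval_f[OF i(1,2)])
    then have "eval_mpoly x u = 0" "eval_mpoly x v = 0"
      using adjoin_independent[OF i(1,2), of "eval_mpoly x u" "eval_mpoly x v"] 
        adjoinI[OF uvs(1)] adjoinI[OF uvs(2)] by simp_all
    then have "u \<in> tower_ideal f m" "v \<in> tower_ideal f m"
      using Suc.IH uvs i by auto
    moreover have "f (Suc n) \<in> tower_ideal f m"
      using f_in_tower_ideal assms(1) i by auto
    moreover have "vars s \<subseteq> {1..m}" "vars (Var (Suc n) :: 'a mpoly) \<subseteq> {1..m}"
      using uvs(3) i by force+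
    ultimately show ?case
      using I_r_closed[of v "Var (Suc n)"] I_l_closed[of "f (Suc n)" s]
        additive_subgroup.a_closed[OF is_additive_subgroup]
      by (simp add: uvs(4))
  }
qed

lemma tower_ideal_eq:
  assumes "n \<le> N"
  shows "tower_ideal f n = {h. vars h \<subseteq> {1..n} \<and> eval_mpoly x h = 0}"
proof
  interpret cring "mpoly_ring n :: 'a mpoly ring" by (rule cring_mpoly_ring)
  show "tower_ideal f n \<subseteq> {h. vars h \<subseteq> {1..n} \<and> eval_mpoly x h = 0}"
    unfolding tower_ideal_def
  proof (rule genideal_minimal[OF ideal_kernel_eval], rule image_subsetI)
    fix i assume "i \<in> {1..n}"
    then have "1 \<le> i" "i \<le> N" "i \<le> n"
      using assms by auto
    then show "f i \<in> {h. vars h \<subseteq> {1..n} \<and> eval_mpoly x h = 0}"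
      using vars_f eval_f by blast
  qed
qed (use kernel_eval_in_tower_ideal[OF assms order_refl] in blast)

lemma residue_class_hom:
  "n \<le> N \<Longrightarrow> residue_class f n \<in> Ring.ring_hom (mpoly_ring n) (tower_ring f n)"
  unfolding tower_ring_def residue_class_def using ideal.rcos_ring_hom[OF ideal_tower_ideal] .

text \<open>
  The bridge between cosets and elements of the algebraic closure: computations in \<open>F_n\<close> are
  decided by evaluation.
\<close>

lemma residue_class_eq_iff:
  assumes "n \<le> N" "vars g \<subseteq> {1..n}" "vars h \<subseteq> {1..n}"
  shows "residue_class f n g = residue_class f n h \<longleftrightarrow> eval_mpoly x g = eval_mpoly x h"
proof -
  interpret cring "mpoly_ring n :: 'a mpoly ring" by (rule cring_mpoly_ring)
  have "\<ominus>\<^bsub>mpoly_ring n\<^esub> h = - h"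
    by (rule minus_equality) (use assms in auto)
  then have "residue_class f n g = residue_class f n h \<longleftrightarrow> g - h \<in> tower_ideal f n"
    unfolding residue_class_def
    using quotient_eq_iff_same_a_r_cos[OF ideal_tower_ideal[OF assms(1)], of g h] assms(2,3)
    by (simp add: a_minus_def)
  then show ?thesis
    using assms vars_diff_subset[of g _ h] by (simp add: tower_ideal_eq)
qed

lemma carrier_tower_ring: "carrier (tower_ring f n) = residue_class f n ` {h. vars h \<subseteq> {1..n}}"
  by (auto simp: tower_ring_def residue_class_def FactRing_def A_RCOSETS_def')

lemma residue_class_simps:
  assumes "n \<le> N" and gh: "vars g \<subseteq> {1..n}" "vars h \<subseteq> {1..n}"
  shows "residue_class f n g \<oplus>\<^bsub>tower_ring f n\<^esub> residue_class f n h = residue_class f n (g + h)"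
    and "residue_class f n g \<otimes>\<^bsub>tower_ring f n\<^esub> residue_class f n h = residue_class f n (g * h)"
  using ring_hom_add[OF residue_class_hom[OF assms(1)]]
    ring_hom_mult[OF residue_class_hom[OF assms(1)]] gh by simp_all

lemma one_tower_ring: "\<one>\<^bsub>tower_ring f n\<^esub> = residue_class f n 1"
  by (simp add: tower_ring_def residue_class_def FactRing_def)

lemma cring_tower_ring: "n \<le> N \<Longrightarrow> cring (tower_ring f n)"
  unfolding tower_ring_def by (rule ideal.quotient_is_cring[OF ideal_tower_ideal cring_mpoly_ring])

lemma zero_tower_ring:
  assumes "n \<le> N"
  shows "\<zero>\<^bsub>tower_ring f n\<^esub> = residue_class f n 0"
  using ring_hom_zero[OF residue_class_hom[OF assms] cring.axioms(1)[OF cring_mpoly_ring]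
      cring.axioms(1)[OF cring_tower_ring[OF assms]]] by simp

lemma field_tower_ring:
  assumes n: "n \<le> N"
  shows "Ring.field (tower_ring f n)"
proof (rule cring.cring_fieldI2[OF cring_tower_ring[OF n]])
  show "\<zero>\<^bsub>tower_ring f n\<^esub> \<noteq> \<one>\<^bsub>tower_ring f n\<^esub>"
    using n by (simp add: zero_tower_ring one_tower_ring residue_class_eq_iff)
  fix a assume "a \<in> carrier (tower_ring f n)" "a \<noteq> \<zero>\<^bsub>tower_ring f n\<^esub>"
  then obtain g where g: "vars g \<subseteq> {1..n}" "a = residue_class f n g"
    and "residue_class f n g \<noteq> residue_class f n 0"
    by (auto simp: carrier_tower_ring zero_tower_ring[OF n])
  then have g0: "eval_mpoly x g \<noteq> 0"
    using residue_class_eq_iff[OF n g(1), of 0] by simp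
  obtain h where h: "vars h \<subseteq> {1..n}" "inverse (eval_mpoly x g) = eval_mpoly x h"
    using adjoin_inverse[OF n adjoinI[OF g(1)]] by (auto simp: adjoin_def)
  have "eval_mpoly x (g * h) = 1"
    using g0 h(2)[symmetric] by simp
  then have "a \<otimes>\<^bsub>tower_ring f n\<^esub> residue_class f n h = \<one>\<^bsub>tower_ring f n\<^esub>"
    using n g h by (simp add: one_tower_ring residue_class_simps residue_class_eq_iff vars_mult_subset)
  then show "\<exists>b\<in>carrier (tower_ring f n). a \<otimes>\<^bsub>tower_ring f n\<^esub> b = \<one>\<^bsub>tower_ring f n\<^esub>"
    using h(1) by (auto simp: carrier_tower_ring)
qed

lemma reduce_coeffs_quadratic:
  assumes "n \<le> N" "vars g \<subseteq> {1..n}"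
  shows "reduce_coeffs f n [:- g, 0, 1:] = [residue_class f n 1, residue_class f n 0, residue_class f n (- g)]"
proof -
  have "residue_class f n 1 \<noteq> \<zero>\<^bsub>tower_ring f n\<^esub>"
    using assms(1) by (simp add: zero_tower_ring residue_class_eq_iff)
  then show ?thesis
    using cring.axioms(1)[OF cring_tower_ring[OF assms(1)]]
    by (simp add: reduce_coeffs_def ring.normalize.simps)
qed

text \<open>
  A root of the reduced polynomial in \<open>F_{i-1}\<close> is represented by a polynomial \<open>h\<close> whose value
  squares to \<open>(x i)^2\<close>; so \<open>x i\<close> would be \<open>\<plusminus>\<close> that value.
\<close>

lemma irreducible_reduce_coeffs:
  assumes i: "1 \<le> i" "i \<le> N"
  defines "F \<equiv> tower_ring f (i - 1)"
  shows "ring_irreducible\<^bsub>poly_ring F\<^esub> (reduce_coeffs f (i - 1) [:- c i, 0, 1:])"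
proof -
  let ?n = "i - 1"
  let ?r = "residue_class f ?n"
  have n: "?n \<le> N"
    using i by simp
  have c: "vars (c i) \<subseteq> {1..?n}"
    by (rule vars_c[OF i])
  interpret F: Ring.field F
    unfolding F_def by (rule field_tower_ring[OF n])
  have one: "?r 1 = \<one>\<^bsub>F\<^esub>" and zero: "?r 0 = \<zero>\<^bsub>F\<^esub>"
    using n by (simp_all add: F_def one_tower_ring zero_tower_ring)
  have rc: "?r (- c i) \<in> carrier F"
    using c by (simp add: F_def carrier_tower_ring)
  have coeffs: "reduce_coeffs f ?n [:- c i, 0, 1:] = [\<one>\<^bsub>F\<^esub>, \<zero>\<^bsub>F\<^esub>, ?r (- c i)]"
    by (simp add: reduce_coeffs_quadratic[OF n c] one zero)
  show ?thesis
    unfolding coeffs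
  proof (rule degree_two_no_root_imp_pirreducible[OF F.field_axioms])
    show "[\<one>\<^bsub>F\<^esub>, \<zero>\<^bsub>F\<^esub>, ?r (- c i)] \<in> carrier (poly_ring F)"
      using rc by (simp add: univ_poly_def polynomial_def)
    show "length [\<one>\<^bsub>F\<^esub>, \<zero>\<^bsub>F\<^esub>, ?r (- c i)] = 3"
      by simp
    fix z assume z: "z \<in> carrier F"
    then obtain h where h: "vars h \<subseteq> {1..?n}" "z = ?r h"
      by (auto simp: F_def carrier_tower_ring)
    show "F.eval [\<one>\<^bsub>F\<^esub>, \<zero>\<^bsub>F\<^esub>, ?r (- c i)] z \<noteq> \<zero>\<^bsub>F\<^esub>"
    proof
      assume "F.eval [\<one>\<^bsub>F\<^esub>, \<zero>\<^bsub>F\<^esub>, ?r (- c i)] z = \<zero>\<^bsub>F\<^esub>"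
      then have "z \<otimes>\<^bsub>F\<^esub> z \<oplus>\<^bsub>F\<^esub> ?r (- c i) = \<zero>\<^bsub>F\<^esub>"
        using z rc by (simp add: numeral_2_eq_2)
      then have "?r (h * h - c i) = ?r 0"
        using h c n by (simp add: zero[symmetric]) (simp add: F_def residue_class_simps vars_mult_subset)
      then have "eval_mpoly x h ^ 2 = x i ^ 2"
        using h c n i
        by (simp add: residue_class_eq_iff vars_diff_subset vars_mult_subset root_squared power2_eq_square[of "eval_mpoly x h"])
      then have "x i = eval_mpoly x h \<or> x i = - eval_mpoly x h"
        by (metis power2_eq_iff)
      then show False
        using root_notin[OF i] adjoinI[OF h(1)] adjoin_uminus[OF adjoinI[OF h(1)]] by metis
    qed
  qed
qed

lemma univariate_view_f:
  assumes "1 \<le> i" "i \<le> N"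
  shows "univariate_view i (f i) [:- c i, 0, 1:]"
proof -
  have "vars (Polynomial.coeff [:- c i, 0, 1:] k) \<subseteq> {1..i - 1}" for k
    using vars_c[OF assms] by (auto simp: coeff_pCons split: nat.split)
  then show ?thesis
    by (simp add: univariate_view_def f_eq[OF assms] power2_eq_square)
qed

lemma field_tower: "l \<le> N \<Longrightarrow> field_tower f l"
  unfolding field_tower_def
proof (intro ballI exI conjI)
  fix i assume "l \<le> N" "i \<in> {1..l}"
  then have "1 \<le> i" "i \<le> N"
    by auto
  then show "univariate_view i (f i) [:- c i, 0, 1:]"
    "ring_irreducible\<^bsub>poly_ring (tower_ring f (i - 1))\<^esub> (reduce_coeffs f (i - 1) [:- c i, 0, 1:])"
    by (rule univariate_view_f, rule irreducible_reduce_coeffs)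
qed simp

lemma tower_map_residue_class:
  assumes i: "1 \<le> i" "i \<le> N" and g: "vars g \<subseteq> {1..i - 1}"
  shows "tower_map f i (residue_class f (i - 1) g) = residue_class f i g"
proof -
  have sub: "tower_ideal f (i - 1) \<subseteq> tower_ideal f i"
    using i by (force simp: tower_ideal_eq)
  have zero: "0 \<in> tower_ideal f (i - 1)"
    using i by (simp add: tower_ideal_eq)
  have closed: "p + q \<in> tower_ideal f i" if "p \<in> tower_ideal f i" "q \<in> tower_ideal f i" for p q
    using that i by (simp add: tower_ideal_eq vars_add_subset)
  show ?thesis
  proof (intro equalityI subsetI)
    fix h assume "h \<in> tower_map f i (residue_class f (i - 1) g)"
    then obtain p q where "p \<in> tower_ideal f i" "q \<in> tower_ideal f (i - 1)" "h = p + (q + g)"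
      by (auto simp: tower_map_def residue_class_def set_add_def' a_r_coset_def')
    then have "p + q \<in> tower_ideal f i" "h = (p + q) + g"
      using closed sub by (auto simp: add.assoc)
    then show "h \<in> residue_class f i g"
      by (auto simp: residue_class_def a_r_coset_def')
  next
    fix h assume "h \<in> residue_class f i g"
    then obtain p where "p \<in> tower_ideal f i" "h = p + (0 + g)"
      by (auto simp: residue_class_def a_r_coset_def')
    then show "h \<in> tower_map f i (residue_class f (i - 1) g)"
      using zero unfolding tower_map_def residue_class_def set_add_def' a_r_coset_def'
      by (auto, metis add_0_right)
  qed
qed

lemma tower_step_degree:
  assumes i: "1 \<le> i" "i \<le> N"
  shows "tower_step_degree f i 2"
proof -
  let ?E = "tower_ring f (i - 1)" and ?F = "tower_ring f i"
  let ?r = "residue_class f i"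
  define S where "S = {g :: 'a mpoly. vars g \<subseteq> {1..i - 1}}"
  have n: "i - 1 \<le> N"
    using i by simp
  have up: "vars g \<subseteq> {1..i}" if "g \<in> S" for g
    using that by (force simp: S_def)
  have X: "vars (Var i :: 'a mpoly) \<subseteq> {1..i}"
    using i by simp
  interpret E: Ring.field ?E by (rule field_tower_ring[OF n])
  interpret F: Ring.field ?F by (rule field_tower_ring[OF i(2)])
  have carrier_E: "carrier ?E = residue_class f (i - 1) ` S"
    by (simp add: carrier_tower_ring S_def)
  have map: "tower_map f i (residue_class f (i - 1) g) = ?r g" if "g \<in> S" for g
    using tower_map_residue_class[OF i] that by (simp add: S_def)
  have img: "tower_map f i ` carrier ?E = ?r ` S"
    unfolding carrier_E image_image using map by simp
  have hom: "tower_map f i \<in> Ring.ring_hom ?E ?F"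
  proof (rule ring_hom_memI)
    fix a b assume "a \<in> carrier ?E" "b \<in> carrier ?E"
    then obtain g h where gh: "g \<in> S" "h \<in> S"
      and ab: "a = residue_class f (i - 1) g" "b = residue_class f (i - 1) h"
      by (auto simp: carrier_E)
    have sum: "g + h \<in> S" and prod: "g * h \<in> S"
      using gh by (simp_all add: S_def vars_add_subset vars_mult_subset)
    show "tower_map f i a \<in> carrier ?F"
      using gh up by (auto simp: ab map carrier_tower_ring)
    have "a \<oplus>\<^bsub>?E\<^esub> b = residue_class f (i - 1) (g + h)" "a \<otimes>\<^bsub>?E\<^esub> b = residue_class f (i - 1) (g * h)"
      using residue_class_simps[OF n, of g h] gh by (simp_all add: ab S_def)
    then show "tower_map f i (a \<otimes>\<^bsub>?E\<^esub> b) = tower_map f i a \<otimes>\<^bsub>?F\<^esub> tower_map f i b"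
      "tower_map f i (a \<oplus>\<^bsub>?E\<^esub> b) = tower_map f i a \<oplus>\<^bsub>?F\<^esub> tower_map f i b"
      using gh sum prod residue_class_simps[OF i(2), of g h] up
      by (simp_all add: ab map)
  next
    show "tower_map f i \<one>\<^bsub>?E\<^esub> = \<one>\<^bsub>?F\<^esub>"
      using map[of 1] by (simp add: one_tower_ring S_def)
  qed
  have dim: "F.dimension 2 (?r ` S) (carrier ?F)"
  proof -
    \<comment> \<open>The span of \<open>1\<close> is the copy of \<open>F_{i-1}\<close>, and that of \<open>1\<close> and \<open>X_i\<close> is all of \<open>F_i\<close>.\<close>
    let ?V = "F.line_extension (?r ` S) (?r 1) {\<zero>\<^bsub>?F\<^esub>}"
    have S0: "0 \<in> S" and S1: "1 \<in> S"
      by (simp_all add: S_def)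
    have V: "?V = ?r ` S"
    proof -
      have "?r u \<otimes>\<^bsub>?F\<^esub> ?r 1 \<oplus>\<^bsub>?F\<^esub> \<zero>\<^bsub>?F\<^esub> = ?r u" if "u \<in> S" for u
        using up[OF that] by (simp add: zero_tower_ring[OF i(2)] residue_class_simps[OF i(2)])
      then show ?thesis
        by (auto simp: F.line_extension_mem_iff)
    qed
    have W: "F.line_extension (?r ` S) (?r (Var i)) (?r ` S) = carrier ?F"
    proof (intro equalityI subsetI)
      fix y assume "y \<in> F.line_extension (?r ` S) (?r (Var i)) (?r ` S)"
      then obtain u v where "u \<in> S" "v \<in> S" "y = ?r v \<otimes>\<^bsub>?F\<^esub> ?r (Var i) \<oplus>\<^bsub>?F\<^esub> ?r u"
        by (auto simp: F.line_extension_mem_iff)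
      then show "y \<in> carrier ?F"
        using up[of u] up[of v] X
        by (simp add: residue_class_simps[OF i(2)] carrier_tower_ring vars_add_subset vars_mult_subset)
    next
      fix y assume "y \<in> carrier ?F"
      then obtain h where h: "vars h \<subseteq> {1..i}" "y = ?r h"
        by (auto simp: carrier_tower_ring)
      obtain u v s where uv: "u \<in> S" "v \<in> S" and s: "vars s \<subseteq> {1..i}"
        "h = u + v * Var i + s * f i"
        using division[OF i h(1)] by (auto simp: S_def)
      have vX: "vars (v * Var i) \<subseteq> {1..i}"
        using up[OF uv(2)] X by (rule vars_mult_subset)
      have vXu: "vars (v * Var i + u) \<subseteq> {1..i}"
        using vX up[OF uv(1)] by (rule vars_add_subset)
      have "eval_mpoly x h = eval_mpoly x (v * Var i + u)"
        by (simp add: s(2) eval_f[OF i])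
      then have "y = ?r (v * Var i + u)"
        using residue_class_eq_iff[OF i(2) h(1) vXu] h(2) by simp
      also have "\<dots> = ?r v \<otimes>\<^bsub>?F\<^esub> ?r (Var i) \<oplus>\<^bsub>?F\<^esub> ?r u"
        using residue_class_simps(1)[OF i(2) vX up[OF uv(1)]]
          residue_class_simps(2)[OF i(2) up[OF uv(2)] X] by simp
      finally show "y \<in> F.line_extension (?r ` S) (?r (Var i)) (?r ` S)"
        using uv unfolding F.line_extension_mem_iff by blast
    qed
    have "F.dimension (Suc 0) (?r ` S) ?V"
    proof (rule F.Suc_dim[OF _ _ F.zero_dim])
      show "?r 1 \<in> carrier ?F" "?r 1 \<notin> {\<zero>\<^bsub>?F\<^esub>}"
        using F.one_not_zero by (simp_all add: one_tower_ring[symmetric])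
    qed
    then have "F.dimension (Suc (Suc 0)) (?r ` S) (F.line_extension (?r ` S) (?r (Var i)) (?r ` S))"
      unfolding V
    proof (rule F.Suc_dim[rotated 2])
      show "?r (Var i) \<in> carrier ?F"
        using X by (simp add: carrier_tower_ring)
      show "?r (Var i) \<notin> ?r ` S"
      proof
        assume "?r (Var i) \<in> ?r ` S"
        then obtain g where "g \<in> S" "?r (Var i) = ?r g"
          by blast
        then have "x i = eval_mpoly x g"
          using residue_class_eq_iff[OF i(2) X up] by simp
        then show False
          using root_notin[OF i] adjoinI[of g] \<open>g \<in> S\<close> by (simp add: S_def)
      qed
    qed
    then show ?thesis
      by (simp add: W numeral_2_eq_2)
  qed
  show ?thesis
    unfolding tower_step_degree_def img
    using E.field_axioms F.field_axioms hom dim by blast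
qed

end

text \<open>
  The step that makes the construction repeatable. In terms of norms: the norm of \<open>x i\<close> to the
  preceding field is \<open>- (x i)^2\<close>, which is not a square there because \<open>-1\<close> is one, while norms
  of squares are squares.
\<close>

lemma (in quadratic_tower) root_nonsquare:
  assumes i: "1 \<le> i" "i \<le> N" and j: "j \<in> adjoin x (i - 1)" "j ^ 2 = -1"
    and z: "z \<in> adjoin x i"
  shows "z ^ 2 \<noteq> x i"
proof
  assume sq: "z ^ 2 = x i"
  let ?K = "adjoin x (i - 1)" and ?\<xi> = "x i"
  obtain u v where uv: "z = u + v * ?\<xi>" "u \<in> ?K" "v \<in> ?K"
    using z adjoin_step[OF i] by blast
  have sq_in: "?\<xi> ^ 2 \<in> ?K"
    using root_squared[OF i] adjoinI[OF vars_c[OF i]] by simp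
  have "(u ^ 2 + v ^ 2 * ?\<xi> ^ 2) + (u * v + u * v - 1) * ?\<xi> = z ^ 2 - ?\<xi>"
    by (simp add: uv(1) power2_eq_square algebra_simps)
  then have "(u ^ 2 + v ^ 2 * ?\<xi> ^ 2) + (u * v + u * v - 1) * ?\<xi> = 0"
    by (simp only: sq) simp
  moreover have "u ^ 2 + v ^ 2 * ?\<xi> ^ 2 \<in> ?K" "u * v + u * v - 1 \<in> ?K"
    unfolding power2_eq_square[of u] power2_eq_square[of v]
    by ((intro adjoin_add adjoin_diff adjoin_mult adjoin_1; fact)+)
  ultimately have "u ^ 2 + v ^ 2 * ?\<xi> ^ 2 = 0 \<and> u * v + u * v - 1 = 0"
    by (intro adjoin_independent[OF i])
  then have *: "u ^ 2 + v ^ 2 * ?\<xi> ^ 2 = 0" and "v \<noteq> 0"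
    by auto
  \<comment> \<open>This makes \<open>\<xi>\<close> equal to \<open>\<plusminus> j u / v\<close>, an element of the smaller field.\<close>
  have "?\<xi> ^ 2 = (j * u * inverse v) ^ 2"
  proof -
    have "v ^ 2 * ?\<xi> ^ 2 = - (u ^ 2)"
      using * by (simp add: add_eq_0_iff)
    then have "?\<xi> ^ 2 = - (u ^ 2) * inverse v ^ 2"
      using \<open>v \<noteq> 0\<close> by (simp add: field_simps)
    then show ?thesis
      using j(2) by (simp add: power_mult_distrib)
  qed
  then have "?\<xi> = j * u * inverse v \<or> ?\<xi> = - (j * u * inverse v)"
    by (metis power2_eq_iff)
  moreover have "j * u * inverse v \<in> ?K"
    using j(1) uv i by (intro adjoin_mult adjoin_inverse) auto
  ultimately show False
    using root_notin[OF i] adjoin_uminus by metis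
qed

section \<open>The field with p^2 elements\<close>

text \<open>
  The root \<open>x_1\<close> of \<open>X_1^2 + 1\<close>; the element written \<open>i\<close> in the comments below.
\<close>

definition im :: "'a::field alg_closure" where
  "im = (SOME j. j ^ 2 = -1)"

lemma im_squared: "im ^ 2 = (-1 :: 'a::field alg_closure)"
  unfolding im_def by (rule someI_ex) (simp add: nth_root_exists)

definition gauss_poly :: "'a::comm_ring_1 \<Rightarrow> 'a \<Rightarrow> 'a mpoly" where
  "gauss_poly u v = Const u + Const v * Var 1"

lemma eval_gauss_poly: "eval_mpoly x (gauss_poly u v) = to_ac u + to_ac v * x 1"
  by (simp add: gauss_poly_def)

lemma vars_gauss_poly: "vars (gauss_poly u v) \<subseteq> {1..1}"
  unfolding gauss_poly_def by (intro vars_add_subset vars_mult_subset) simp_all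

lemma gauss_poly_eq_single:
  "gauss_poly u v = Poly_Mapping.single 0 u + Poly_Mapping.single (Poly_Mapping.single 1 1) v"
  by (simp add: gauss_poly_def Const_def Var_def mult_single)

lemma degree_less_2_imp_gauss_poly:
  fixes g :: "'a::comm_ring_1 mpoly"
  assumes "vars g \<subseteq> {1..1}" and deg: "\<forall>m\<in>Poly_Mapping.keys g. Poly_Mapping.lookup m 1 < 2"
  shows "g = gauss_poly (Poly_Mapping.lookup g 0) (Poly_Mapping.lookup g (Poly_Mapping.single 1 1))"
proof (rule poly_mapping_eqI)
  fix m
  let ?X = "Poly_Mapping.single 1 1 :: nat \<Rightarrow>\<^sub>0 nat"
  have X: "?X \<noteq> 0"
    by (metis lookup_single_eq lookup_zero zero_neq_one)
  have "Poly_Mapping.lookup g m = 0" if "m \<noteq> 0" "m \<noteq> ?X"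
  proof (rule ccontr)
    assume "Poly_Mapping.lookup g m \<noteq> 0"
    then have m: "m \<in> Poly_Mapping.keys g"
      by (simp add: in_keys_iff)
    then have "Poly_Mapping.keys m \<subseteq> {1}"
      using assms(1) by (auto simp: vars_def)
    then have "m = Poly_Mapping.single 1 (Poly_Mapping.lookup m 1)"
      by (intro poly_mapping_eqI) (auto simp: lookup_single when_def in_keys_iff)
    moreover have "Poly_Mapping.lookup m 1 = 0 \<or> Poly_Mapping.lookup m 1 = 1"
      using deg m by force
    ultimately show False
      using that by (metis single_zero)
  qed
  then show "Poly_Mapping.lookup g m = Poly_Mapping.lookup
      (gauss_poly (Poly_Mapping.lookup g 0) (Poly_Mapping.lookup g ?X)) m"
    using X by (cases "m = 0"; cases "m = ?X")
      (simp_all add: gauss_poly_eq_single lookup_add lookup_single)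
qed

text \<open>
  The multiplier \<open>m\<close> of the shift is prime to \<open>q\<close>, so \<open>m k + c\<close> takes every value modulo \<open>q\<close>. That
  a largest admissible \<open>m\<close> exists has to be shown before \<open>GREATEST\<close> can be evaluated: \<open>m = 1\<close> is
  admissible and \<open>q\<close> is a bound.
\<close>

lemma standard_affine_shift_surj:
  assumes "1 < q" "0 \<le> n" "n < q"
  obtains k :: nat where "k > 0" "standard_affine_shift q (int k) = n"
proof -
  define P where "P = (\<lambda>m::int. rat_of_int m \<le> 4 / 5 * rat_of_int q \<and> gcd m q = 1)"
  define c where "c = \<lfloor>2 / 3 * rat_of_int q\<rfloor>"
  have bound: "m \<le> q" if "P m" for m
  proof -
    have "rat_of_int m \<le> rat_of_int q"
      using that assms(1) unfolding P_def by linarith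
    then show ?thesis
      by simp
  qed
  have "P 1"
    using assms(1) by (simp add: P_def)
  have fin: "finite {m \<in> {1..q}. P m}"
    by (rule finite_subset[of _ "{1..q}"]) auto
  define m where "m = Max {m \<in> {1..q}. P m}"
  have m_in: "m \<in> {m \<in> {1..q}. P m}"
    unfolding m_def
  proof (rule Max_in[OF fin])
    have "1 \<in> {m \<in> {1..q}. P m}"
      using \<open>P 1\<close> assms(1) by simp
    then show "{m \<in> {1..q}. P m} \<noteq> {}"
      by blast
  qed
  have "(GREATEST m. P m) = m"
  proof (rule Greatest_equality)
    show "P m"
      using m_in by simp
    show "m' \<le> m" if "P m'" for m'
    proof (cases "m' \<ge> 1")
      case True
      then show ?thesis
        unfolding m_def using that bound[OF that] by (intro Max_ge[OF fin]) auto
    next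
      case False
      then show ?thesis
        using m_in by auto
    qed
  qed
  then have shift: "standard_affine_shift q i = (m * i + c) mod q" for i
    by (simp add: standard_affine_shift_def P_def c_def)
  have "coprime m q"
    using m_in by (simp add: P_def coprime_iff_gcd_eq_1)
  then obtain w where w: "[m * w = 1] (mod q)"
    using cong_solve_coprime_int by blast
  \<comment> \<open>Adding \<open>q\<close> keeps the index positive: the loop never uses the index \<open>0\<close>.\<close>
  define k where "k = nat ((w * (n - c)) mod q + q)"
  have k: "int k = (w * (n - c)) mod q + q"
    using assms(1) by (simp add: k_def)
  have "[m * int k + c = m * (w * (n - c)) + c] (mod q)"
    unfolding k by (intro cong_add cong_mult cong_refl) (simp add: cong_def)
  also have "m * (w * (n - c)) + c = (m * w) * (n - c) + c"
    by simp
  also have "[(m * w) * (n - c) + c = 1 * (n - c) + c] (mod q)"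
    by (intro cong_add cong_mult cong_refl w)
  finally have "standard_affine_shift q (int k) = n"
    using assms by (simp add: shift cong_def)
  moreover have "k > 0"
    using assms(1) by (simp add: k_def add_nonneg_pos)
  ultimately show ?thesis
    using that by blast
qed

text \<open>
  The parameter \<open>T\<close> ties the locale to the type \<open>'p\<close>, whose cardinality is the prime \<open>p\<close>.
\<close>

locale three_mod_four =
  fixes T :: "'p::prime_card itself"
  assumes four_dvd: "4 dvd CARD('p) + 1"
begin

lemma card_eq_4k_plus_3: obtains k where "CARD('p) = 4 * k + 3"
proof -
  obtain m where "CARD('p) + 1 = 4 * m"
    using four_dvd by auto
  then show ?thesis
    using that[of "m - 1"] by (cases m) auto
qed

text \<open>
  Here the congruence on \<open>p\<close> acts through parity: \<open>(p - 1) / 2\<close> is odd.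
\<close>

lemma power_card_of_sqrt_minus_one:
  fixes z :: "'a::comm_ring_1"
  assumes "z ^ 2 = -1"
  shows "z ^ CARD('p) = - z"
proof -
  obtain k where "CARD('p) = 4 * k + 3"
    by (rule card_eq_4k_plus_3)
  then have "CARD('p) = Suc (2 * (2 * k + 1))"
    by simp
  then have "z ^ CARD('p) = (z ^ 2) ^ (2 * k + 1) * z"
    by (simp only: power_Suc2 power_mult)
  then show ?thesis
    by (simp add: assms)
qed

lemma minus_one_nonsquare: "(z :: 'p mod_ring) ^ 2 \<noteq> -1"
proof
  assume z: "z ^ 2 = -1"
  obtain k where k: "CARD('p) = 4 * k + 3"
    by (rule card_eq_4k_plus_3)
  \<comment> \<open>By Fermat, \<open>z = z^p\<close>, while \<open>z^p = - z\<close> since \<open>p\<close> is \<open>3\<close> modulo \<open>4\<close>.\<close>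
  have "z = - z"
    using power_card_of_sqrt_minus_one[OF z] finite_field_power_card_eq_same[of z] by simp
  then have "of_nat 2 * z = 0"
    by (simp add: eq_neg_iff_add_eq_0)
  then have "of_nat 2 = (0 :: 'p mod_ring)"
    using z by auto
  then have "CARD('p) dvd 2"
    by (rule of_nat_0_mod_ring_dvd)
  then show False
    using dvd_imp_le[of "CARD('p)" 2] k by simp
qed

lemma im_notin: "im \<notin> range (to_ac :: 'p mod_ring \<Rightarrow> _)"
proof
  assume "im \<in> range (to_ac :: 'p mod_ring \<Rightarrow> _)"
  then obtain z :: "'p mod_ring" where "im = to_ac z"
    by blast
  then have "to_ac (z ^ 2) = to_ac (-1)"
    using im_squared[where ?'a = "'p mod_ring"] by simp
  then show False
    using minus_one_nonsquare by (simp only: to_ac_eq_iff)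
qed

text \<open>
  The field with \<open>p^2\<close> elements is a tower of height \<open>1\<close> over the prime field.
\<close>

sublocale gauss: quadratic_tower
  "\<lambda>_. im :: 'p mod_ring alg_closure" gauss_seq "\<lambda>_. -1" 1
proof
  fix i :: nat assume "1 \<le> i" "i \<le> 1"
  then have i: "i = 1"
    by simp
  show "Var 1 ^ 2 + 1 = (Var i ^ 2 - (-1) :: 'p mod_ring mpoly)"
    by (simp add: i)
  show "vars (- 1 :: 'p mod_ring mpoly) \<subseteq> {1..i - 1}"
    by simp
  show "im ^ 2 = eval_mpoly (\<lambda>_. im) (- 1 :: 'p mod_ring mpoly)"
    by (simp add: im_squared)
  show "im \<notin> adjoin (\<lambda>_. im :: 'p mod_ring alg_closure) (i - 1)"
    using im_notin by (simp add: i adjoin_zero)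
qed

abbreviation K1 :: "'p mod_ring alg_closure set" where
  "K1 \<equiv> adjoin (\<lambda>_. im) 1"

lemma K1_eq: "K1 = (\<lambda>(u, v). to_ac u + to_ac v * im) ` UNIV"
  using gauss.adjoin_step[of 1] by (auto simp: adjoin_zero image_iff)

lemma coords_unique:
  "to_ac u + to_ac v * im = to_ac u' + to_ac v' * im \<longleftrightarrow> u = u' \<and> v = (v' :: 'p mod_ring)"
proof
  assume "to_ac u + to_ac v * im = to_ac u' + to_ac v' * im"
  then have "to_ac (u - u') + to_ac (v - v') * im = 0"
    by (simp add: algebra_simps)
  then have "to_ac (u - u') = 0 \<and> to_ac (v - v') = 0"
    by (intro gauss.adjoin_independent[of 1]) (simp_all add: adjoin_zero del: to_ac_diff)
  then show "u = u' \<and> v = v'"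
    by simp
qed simp

lemma card_K1: "card K1 = CARD('p) ^ 2"
proof -
  have "inj (\<lambda>(u :: 'p mod_ring, v). to_ac u + to_ac v * im)"
    using coords_unique by (auto intro!: injI)
  then have "card K1 = card (UNIV :: ('p mod_ring \<times> 'p mod_ring) set)"
    unfolding K1_eq by (rule card_image)
  then show ?thesis
    by (simp add: power2_eq_square flip: UNIV_Times_UNIV)
qed

text \<open>
  The Frobenius map acts as complex conjugation \<open>u + v i \<mapsto> u - v i\<close>, because
  \<open>i^p = - i\<close>; applying it twice gives the identity.
\<close>

lemma K1_power_card: "y \<in> K1 \<Longrightarrow> y ^ (CARD('p) ^ 2) = y"
proof -
  let ?p = "CARD('p)"
  assume "y \<in> K1"
  then obtain u v :: "'p mod_ring" where y: "y = to_ac u + to_ac v * im"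
    by (auto simp: K1_eq)
  have frob: "(a + b) ^ ?p = a ^ ?p + b ^ ?p" for a b :: "'p mod_ring alg_closure"
    by (rule freshmans_dream) (simp_all add: prime_card)
  have fix_p: "to_ac a ^ ?p = to_ac a" for a :: "'p mod_ring"
    using finite_field_power_card_eq_same[of a] by (simp flip: to_ac_power)
  have step: "(to_ac a + to_ac b * im) ^ ?p = to_ac a + to_ac (- b) * im" for a b :: "'p mod_ring"
    by (simp add: frob power_mult_distrib fix_p power_card_of_sqrt_minus_one im_squared)
  show ?thesis
    by (simp add: y power2_eq_square power_mult step del: to_ac_minus)
qed

lemma two_times_half: "2 * ((CARD('p) ^ 2 - 1) div 2) = CARD('p) ^ 2 - 1"
  and card_sq_gt_1: "CARD('p) ^ 2 > 1"
proof -
  obtain k where k: "CARD('p) = 4 * k + 3"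
    by (rule card_eq_4k_plus_3)
  then have "even (CARD('p) ^ 2 - 1)"
    by simp
  then show "2 * ((CARD('p) ^ 2 - 1) div 2) = CARD('p) ^ 2 - 1"
    by simp
  show "CARD('p) ^ 2 > 1"
    using k by (simp add: one_less_power)
qed

lemma K1_square_power:
  assumes "z \<in> K1" "z \<noteq> 0"
  shows "(z ^ 2) ^ ((CARD('p) ^ 2 - 1) div 2) = 1"
proof -
  have "z * z ^ (CARD('p) ^ 2 - 1) = z * 1"
    using K1_power_card[OF assms(1)] card_sq_gt_1 by (simp flip: power_Suc)
  then have "z ^ (CARD('p) ^ 2 - 1) = 1"
    using assms(2) by (simp only: mult_cancel_left) simp
  then show ?thesis
    by (simp add: two_times_half flip: power_mult)
qed

lemma ex_nonsquare: "\<exists>y\<in>K1. y \<noteq> 0 \<and> y ^ ((CARD('p) ^ 2 - 1) div 2) \<noteq> 1"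
proof (rule ccontr)
  assume none: "\<not> ?thesis"
  define M where "M = (CARD('p) ^ 2 - 1) div 2"
  define P where "P = Polynomial.monom 1 M - (1 :: 'p mod_ring alg_closure poly)"
  have M: "2 * M = CARD('p) ^ 2 - 1" "M > 0"
    using two_times_half card_sq_gt_1 by (auto simp: M_def)
  have "Polynomial.coeff P M = 1"
    using M(2) by (simp add: P_def)
  then have P: "P \<noteq> 0"
    by auto
  have deg: "Polynomial.degree P \<le> M"
    unfolding P_def by (intro degree_diff_le degree_monom_le) simp
  have "CARD('p) ^ 2 - 1 = card (K1 - {0})"
    unfolding card_Diff_singleton[OF adjoin_0] card_K1 ..
  also have "\<dots> \<le> card {y. poly P y = 0}"
    using none P by (intro card_mono poly_roots_finite) (auto simp: P_def M_def poly_monom)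
  also have "\<dots> \<le> M"
    using card_poly_roots_bound[OF P] deg by simp
  finally show False
    using M by simp
qed

section \<open>The algorithm NonRthPower\<close>

abbreviation res :: "'p mod_ring mpoly \<Rightarrow> 'p mod_ring mpoly set" where
  "res \<equiv> residue_class gauss_seq 1"

lemma carrier_Fp2: "carrier (Fp2 :: 'p mod_ring mpoly set ring) = range (\<lambda>(u, v). res (gauss_poly u v))"
proof (intro equalityI subsetI)
  fix a :: "'p mod_ring mpoly set" assume "a \<in> carrier Fp2"
  then obtain h where h: "vars h \<subseteq> {1..1}" "a = res h"
    by (auto simp: Fp2_def gauss.carrier_tower_ring)
  then obtain u v where "eval_mpoly (\<lambda>_. im) h = to_ac u + to_ac v * im"
    using adjoinI[OF h(1), of "\<lambda>_. im"] by (auto simp: K1_eq)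
  then have "res h = res (gauss_poly u v)"
    using gauss.residue_class_eq_iff[OF order_refl h(1) vars_gauss_poly] by (simp add: eval_gauss_poly)
  then show "a \<in> range (\<lambda>(u, v). res (gauss_poly u v))"
    using h(2) by auto
qed (use vars_gauss_poly in \<open>auto simp: Fp2_def gauss.carrier_tower_ring intro!: imageI\<close>)

lemma res_gauss_poly_eq_iff:
  "res (gauss_poly u v) = res (gauss_poly u' v') \<longleftrightarrow> u = u' \<and> v = v'"
  using gauss.residue_class_eq_iff[OF order_refl vars_gauss_poly vars_gauss_poly]
  by (simp add: eval_gauss_poly coords_unique)

lemma res_power:
  assumes "vars g \<subseteq> {1..1}"
  shows "vars (g ^ k) \<subseteq> {1..1}" and "res g [^]\<^bsub>Fp2\<^esub> (k :: nat) = res (g ^ k)"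
proof -
  show vars: "vars (g ^ k) \<subseteq> {1..1}" for k
    using assms by (induction k) (simp_all add: vars_mult_subset)
  interpret cring "Fp2 :: 'p mod_ring mpoly set ring"
    unfolding Fp2_def by (rule gauss.cring_tower_ring) simp
  show "res g [^]\<^bsub>Fp2\<^esub> k = res (g ^ k)"
  proof (induction k)
    case 0
    show ?case
      by (simp add: Fp2_def gauss.one_tower_ring)
  next
    case (Suc k)
    then show ?case
      using gauss.residue_class_simps(2)[OF order_refl vars[of k] assms]
      by (simp add: Fp2_def mult.commute)
  qed
qed

text \<open>
  Division with remainder by \<open>p\<close> recovers both digits from the number.
\<close>

lemma steinitz_elem_eq:
  assumes "0 \<le> k0" "k0 < int CARD('p)" "0 \<le> k1" "k1 < int CARD('p)"
  shows "steinitz_elem (k0 + k1 * int CARD('p)) = res (gauss_poly (of_int k0) (of_int k1))"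
  unfolding steinitz_elem_def
proof (rule the_equality)
  show "has_steinitz_number (res (gauss_poly (of_int k0) (of_int k1))) (k0 + k1 * int CARD('p))"
    using assms unfolding has_steinitz_number_def gauss_poly_def by blast
  fix a :: "'p mod_ring mpoly set"
  assume "has_steinitz_number a (k0 + k1 * int CARD('p))"
  then obtain l0 l1 where l: "0 \<le> l0" "l0 < int CARD('p)" "0 \<le> l1" "l1 < int CARD('p)"
    "a = res (gauss_poly (of_int l0) (of_int l1))" "k0 + k1 * int CARD('p) = l0 + l1 * int CARD('p)"
    unfolding has_steinitz_number_def gauss_poly_def by blast
  have "k0 = (k0 + k1 * int CARD('p)) mod int CARD('p)" "k1 = (k0 + k1 * int CARD('p)) div int CARD('p)"
    using assms by simp_all
  moreover have "l0 = (l0 + l1 * int CARD('p)) mod int CARD('p)" "l1 = (l0 + l1 * int CARD('p)) div int CARD('p)"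
    using l by simp_all
  ultimately have "k0 = l0" "k1 = l1"
    using l(6) by metis+
  then show "a = res (gauss_poly (of_int k0) (of_int k1))"
    using l(5) by simp
qed

lemma steinitz_elem_in_carrier:
  assumes "0 \<le> n" "n < int CARD('p) ^ 2"
  shows "steinitz_elem n \<in> carrier (Fp2 :: 'p mod_ring mpoly set ring)"
proof -
  let ?p = "int CARD('p)"
  have "n div ?p * ?p < ?p * ?p"
  proof -
    have "0 \<le> n mod ?p"
      by simp
    then show ?thesis
      using assms(2) div_mult_mod_eq[of n ?p] unfolding power2_eq_square by linarith
  qed
  then have "n div ?p < ?p"
    by (rule mult_right_less_imp_less) simp
  then have "steinitz_elem (n mod ?p + n div ?p * ?p)
      = res (gauss_poly (of_int (n mod ?p)) (of_int (n div ?p)))"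
    using assms by (intro steinitz_elem_eq) (simp_all add: pos_imp_zdiv_nonneg_iff)
  then show ?thesis
    by (auto simp: carrier_Fp2)
qed

lemma ex_steinitz_number:
  assumes "a \<in> carrier (Fp2 :: 'p mod_ring mpoly set ring)"
  obtains n where "0 \<le> n" "n < int CARD('p) ^ 2" "a = steinitz_elem n"
proof -
  let ?p = "int CARD('p)"
  obtain u v where uv: "a = res (gauss_poly u v)"
    using assms by (auto simp: carrier_Fp2)
  obtain k0 k1 where k: "k0 < CARD('p)" "u = of_nat k0" "k1 < CARD('p)" "v = of_nat k1"
    using surj_of_nat_mod_ring by metis
  have "steinitz_elem (int k0 + int k1 * ?p) = a"
    using steinitz_elem_eq[of "int k0" "int k1"] k uv by simp
  moreover have "int k0 + int k1 * ?p < ?p ^ 2"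
  proof -
    have "k0 + k1 * CARD('p) < (k1 + 1) * CARD('p)"
      unfolding distrib_right using k(1) by simp
    also have "\<dots> \<le> CARD('p) * CARD('p)"
      using k by (intro mult_right_mono) auto
    finally show ?thesis
      by (simp add: power2_eq_square flip: of_nat_add of_nat_mult)
  qed
  ultimately show ?thesis
    using that[of "int k0 + int k1 * ?p"] by simp
qed

lemma res_eq_zero_iff: "vars g \<subseteq> {1..1} \<Longrightarrow> res g = \<zero>\<^bsub>Fp2\<^esub> \<longleftrightarrow> eval_mpoly (\<lambda>_. im) g = 0"
  and res_eq_one_iff: "vars g \<subseteq> {1..1} \<Longrightarrow> res g = \<one>\<^bsub>Fp2\<^esub> \<longleftrightarrow> eval_mpoly (\<lambda>_. im) g = 1"
  using gauss.residue_class_eq_iff[OF order_refl, of g 0] gauss.residue_class_eq_iff[OF order_refl, of g 1]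
  by (simp_all add: Fp2_def gauss.zero_tower_ring gauss.one_tower_ring)

lemma non_rth_power_terminates:
  obtains a :: "'p mod_ring mpoly set" where "non_rth_power 2 = Some a" "a \<in> carrier Fp2"
    "a \<noteq> \<zero>\<^bsub>Fp2\<^esub>" "a [^]\<^bsub>Fp2\<^esub> ((CARD('p) ^ 2 - 1) div 2) \<noteq> \<one>\<^bsub>Fp2\<^esub>"
proof -
  let ?q = "int CARD('p) ^ 2" and ?M = "(CARD('p) ^ 2 - 1) div 2"
  define cond :: "int \<times> 'p mod_ring mpoly set \<Rightarrow> bool" where
    "cond = (\<lambda>(i, a). a = \<zero>\<^bsub>Fp2\<^esub> \<or> a [^]\<^bsub>Fp2\<^esub> ?M = \<one>\<^bsub>Fp2\<^esub>)"
  define step :: "int \<times> 'p mod_ring mpoly set \<Rightarrow> int \<times> 'p mod_ring mpoly set" where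
    "step = (\<lambda>(i, a). (i + 1, steinitz_elem (standard_affine_shift ?q (i + 1))))"
  define s0 :: "int \<times> 'p mod_ring mpoly set" where "s0 = (0, \<zero>\<^bsub>Fp2\<^esub>)"
  have q: "1 < ?q"
    using card_sq_gt_1 by (simp flip: of_nat_power)
  have state: "(step ^^ Suc k) s0 = (int (Suc k), steinitz_elem (standard_affine_shift ?q (int (Suc k))))" for k
    by (induction k) (simp_all add: step_def s0_def add.commute)
  have "\<exists>k. \<not> cond ((step ^^ k) s0)"
  proof -
    obtain y where y: "y \<in> K1" "y \<noteq> 0" "y ^ ?M \<noteq> 1"
      using ex_nonsquare by blast
    then obtain h where h: "vars h \<subseteq> {1..1}" "y = eval_mpoly (\<lambda>_. im) h"
      by (auto simp: adjoin_def)
    have "res h \<in> carrier Fp2"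
      using h(1) by (simp add: Fp2_def gauss.carrier_tower_ring)
    then obtain n where n: "0 \<le> n" "n < ?q" "res h = steinitz_elem n"
      by (rule ex_steinitz_number)
    obtain k where "k > 0" "standard_affine_shift ?q (int k) = n"
      using standard_affine_shift_surj[OF q n(1,2)] .
    then have "(step ^^ k) s0 = (int k, res h)"
      using state[of "k - 1"] n(3) by simp
    moreover have "res h \<noteq> \<zero>\<^bsub>Fp2\<^esub>" "res h [^]\<^bsub>Fp2\<^esub> ?M \<noteq> \<one>\<^bsub>Fp2\<^esub>"
      using y(2,3) h(2) res_eq_zero_iff[OF h(1)] res_power(2)[OF h(1)]
        res_eq_one_iff[OF res_power(1)[OF h(1)]] by simp_all
    ultimately have "\<not> cond ((step ^^ k) s0)"
      by (simp add: cond_def)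
    then show ?thesis ..
  qed
  then obtain i a where result: "while_option cond step s0 = Some (i, a)"
    by (metis while_option_def surj_pair)
  have "a \<in> carrier Fp2"
  proof -
    have "snd s0 \<in> carrier Fp2"
      unfolding s0_def Fp2_def using gauss.cring_tower_ring[OF order_refl]
      by (simp add: cring.cring_simprules(2))
    moreover have "snd (step s) \<in> carrier Fp2" for s
    proof -
      have "0 \<le> standard_affine_shift ?q i" "standard_affine_shift ?q i < ?q" for i
        using q by (simp_all add: standard_affine_shift_def Let_def)
      then show ?thesis
        by (simp add: step_def steinitz_elem_in_carrier split: prod.split)
    qed
    ultimately have "snd (i, a) \<in> carrier Fp2"
      using while_option_rule[OF _ result, of "\<lambda>s. snd s \<in> carrier Fp2"] by blast
    then show ?thesis
      by simp
  qed
  moreover have "\<not> cond (i, a)"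
    using while_option_stop[OF result] .
  moreover have "non_rth_power 2 = Some a"
    using result unfolding non_rth_power_def cond_def step_def s0_def by simp
  ultimately show ?thesis
    using that by (simp add: cond_def)
qed

lemma Fp2_rep_res_gauss_poly: "Fp2_rep (res (gauss_poly u v)) = gauss_poly u v"
  unfolding Fp2_rep_def
proof (rule the_equality)
  have "Poly_Mapping.keys (gauss_poly u v) \<subseteq> {0, Poly_Mapping.single 1 1}"
    unfolding gauss_poly_eq_single
    using Poly_Mapping.keys_add[of "Poly_Mapping.single 0 u" "Poly_Mapping.single (Poly_Mapping.single 1 1) v"]
    by (auto split: if_splits)
  then show "gauss_poly u v \<in> carrier (mpoly_ring 1) \<and>
      (\<forall>m\<in>Poly_Mapping.keys (gauss_poly u v). Poly_Mapping.lookup m 1 < 2) \<and>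
      res (gauss_poly u v) = res (gauss_poly u v)"
    using vars_gauss_poly[of u v] by auto
next
  fix g assume "g \<in> carrier (mpoly_ring 1) \<and>
      (\<forall>m\<in>Poly_Mapping.keys g. Poly_Mapping.lookup m 1 < 2) \<and> res g = res (gauss_poly u v)"
  then show "g = gauss_poly u v"
    using degree_less_2_imp_gauss_poly[of g] by (metis mem_Collect_eq mpoly_ring_simps(1) res_gauss_poly_eq_iff)
qed

lemma
  assumes "a \<in> carrier (Fp2 :: 'p mod_ring mpoly set ring)"
  shows vars_Fp2_rep: "vars (Fp2_rep a) \<subseteq> {1..1}"
    and res_Fp2_rep: "res (Fp2_rep a) = a"
proof -
  obtain u v where "a = res (gauss_poly u v)"
    using assms by (auto simp: carrier_Fp2)
  then show "vars (Fp2_rep a) \<subseteq> {1..1}" "res (Fp2_rep a) = a"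
    using vars_gauss_poly[of u v] by (simp_all add: Fp2_rep_res_gauss_poly)
qed

text \<open>
  If \<open>a\<close> were the square of a nonzero element, Fermat's theorem would give \<open>a^((p^2 - 1) / 2) = 1\<close>,
  and the loop would not have stopped at \<open>a\<close>.
\<close>

lemma Fp2_rep_nonsquare:
  assumes a: "a \<in> carrier (Fp2 :: 'p mod_ring mpoly set ring)" "a \<noteq> \<zero>\<^bsub>Fp2\<^esub>"
    "a [^]\<^bsub>Fp2\<^esub> ((CARD('p) ^ 2 - 1) div 2) \<noteq> \<one>\<^bsub>Fp2\<^esub>"
    and z: "z \<in> K1"
  shows "z ^ 2 \<noteq> eval_mpoly (\<lambda>_. im) (Fp2_rep a)"
proof
  let ?g = "Fp2_rep a"
  note g = vars_Fp2_rep[OF a(1)] res_Fp2_rep[OF a(1)]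
  assume sq: "z ^ 2 = eval_mpoly (\<lambda>_. im) ?g"
  have "eval_mpoly (\<lambda>_. im) ?g \<noteq> 0"
    using res_eq_zero_iff[OF g(1)] a(2) g(2) by simp
  then have "z \<noteq> 0"
    using sq by auto
  then have "eval_mpoly (\<lambda>_. im) ?g ^ ((CARD('p) ^ 2 - 1) div 2) = 1"
    using K1_square_power[OF z] by (simp add: sq)
  then have "res ?g [^]\<^bsub>Fp2\<^esub> ((CARD('p) ^ 2 - 1) div 2) = \<one>\<^bsub>Fp2\<^esub>"
    using res_power(2)[OF g(1)] res_eq_one_iff[OF res_power(1)[OF g(1)]] by simp
  then show False
    using a(3) g(2) by simp
qed

section \<open>The tower of iterated square roots\<close>

text \<open>
  The tower and the non-square for its next step are established together: that \<open>(x (n + 1))^2\<close> is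
  not a square at level \<open>n\<close> says that \<open>x (n + 1)\<close> is a new element, so the tower
  extends by one level, and then \<open>x (n + 1) = (x (n + 2))^2\<close> is not a square at the new
  level.
\<close>

lemma quadratic_tower_f2:
  fixes x :: "nat \<Rightarrow> 'p mod_ring alg_closure"
  assumes a: "a \<in> carrier (Fp2 :: 'p mod_ring mpoly set ring)" "a \<noteq> \<zero>\<^bsub>Fp2\<^esub>"
    "a [^]\<^bsub>Fp2\<^esub> ((CARD('p) ^ 2 - 1) div 2) \<noteq> \<one>\<^bsub>Fp2\<^esub>"
    and x1: "x 1 = im" and x2: "x 2 ^ 2 = eval_mpoly (\<lambda>_. im) (Fp2_rep a)"
    and x3: "\<And>i. 2 \<le> i \<Longrightarrow> x (Suc i) ^ 2 = x i"
  defines "c \<equiv> \<lambda>i. if i \<le> 1 then -1 else if i = 2 then Fp2_rep a else Var (i - 1)"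
  assumes "1 \<le> n"
  shows "quadratic_tower x (f2 a) c n \<and> (\<forall>z\<in>adjoin x n. z ^ 2 \<noteq> x (Suc n) ^ 2)"
  using \<open>1 \<le> n\<close>
proof (induction n rule: dec_induct)
  case base
  have K1: "adjoin x 1 = K1"
    by (rule adjoin_cong) (metis x1 le_antisym)
  have "quadratic_tower x (f2 a) c 1"
  proof
    fix i :: nat assume "1 \<le> i" "i \<le> 1"
    then have i: "i = 1"
      by simp
    show "f2 a i = Var i ^ 2 - c i" "vars (c i) \<subseteq> {1..i - 1}" "x i ^ 2 = eval_mpoly x (c i)"
      by (simp_all add: i f2_def c_def x1 im_squared)
    show "x i \<notin> adjoin x (i - 1)"
      using im_notin by (simp add: i adjoin_zero x1)
  qed
  moreover have "z ^ 2 \<noteq> x (Suc 1) ^ 2" if "z \<in> adjoin x 1" for z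
    using Fp2_rep_nonsquare[OF a, of z] that x2 K1 by (simp add: numeral_2_eq_2 One_nat_def)
  ultimately show ?case
    by blast
next
  case (step n)
  then interpret quadratic_tower x "f2 a" c n
    by simp
  have c: "vars (c (Suc n)) \<subseteq> {1..n} \<and> x (Suc n) ^ 2 = eval_mpoly x (c (Suc n))"
  proof (cases "n = 1")
    case True
    have "eval_mpoly x (Fp2_rep a) = eval_mpoly (\<lambda>_. im) (Fp2_rep a)"
      by (rule eval_mpoly_cong[OF vars_Fp2_rep[OF a(1)]]) (use x1 in simp)
    then show ?thesis
      using True vars_Fp2_rep[OF a(1)] x2 by (simp add: c_def numeral_2_eq_2 One_nat_def)
  next
    case False
    then show ?thesis
      using step.hyps(1) x3[of n] by (simp add: c_def)
  qed
  have "x (Suc n) \<notin> adjoin x n"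
    using step.IH by blast
  have tower: "quadratic_tower x (f2 a) c (Suc n)"
  proof
    fix i assume i: "1 \<le> i" "i \<le> Suc n"
    show "f2 a i = Var i ^ 2 - c i"
    proof (cases "i \<le> 1")
      case True
      then have "i = 1"
        using i(1) by simp
      then show ?thesis
        by (simp add: f2_def c_def)
    qed (simp add: f2_def c_def)
    consider "i \<le> n" | "i = Suc n"
      using i(2) by linarith
    then show "vars (c i) \<subseteq> {1..i - 1}" "x i ^ 2 = eval_mpoly x (c i)" "x i \<notin> adjoin x (i - 1)"
      using vars_c[OF i(1)] root_squared[OF i(1)] root_notin[OF i(1)] c \<open>x (Suc n) \<notin> adjoin x n\<close>
      by (cases; simp)+
  qed
  moreover have "z ^ 2 \<noteq> x (Suc (Suc n)) ^ 2" if "z \<in> adjoin x (Suc n)" for z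
  proof -
    have "im \<in> adjoin x n"
      using adjoin_gen[of 1 n x] step.hyps(1) x1 by simp
    then have "z ^ 2 \<noteq> x (Suc n)"
      using quadratic_tower.root_nonsquare[OF tower, of "Suc n" im z] that im_squared by simp
    then show ?thesis
      using x3[of "Suc n"] step.hyps(1) by simp
  qed
  ultimately show ?case
    by blast
qed

end

theorem proposition5p4:
  assumes "4 dvd CARD('p::prime_card) + 1"
  shows "\<exists>a :: 'p mod_ring mpoly set. non_rth_power 2 = Some a \<and>
           (\<forall>l\<ge>1. field_tower (f2 a) l \<and> (\<forall>i\<in>{1..l}. tower_step_degree (f2 a) i 2))"
proof -
  interpret three_mod_four "TYPE('p)"
    by unfold_locales (rule assms)
  obtain a :: "'p mod_ring mpoly set" where a: "non_rth_power 2 = Some a" "a \<in> carrier Fp2"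
    "a \<noteq> \<zero>\<^bsub>Fp2\<^esub>" "a [^]\<^bsub>Fp2\<^esub> ((CARD('p) ^ 2 - 1) div 2) \<noteq> \<one>\<^bsub>Fp2\<^esub>"
    by (rule non_rth_power_terminates)
  define rt :: "'p mod_ring alg_closure \<Rightarrow> 'p mod_ring alg_closure" where
    "rt y = (SOME z. z ^ 2 = y)" for y
  have rt: "rt y ^ 2 = y" for y
    unfolding rt_def by (rule someI_ex) (simp add: nth_root_exists)
  \<comment> \<open>The roots are \<open>i\<close>, a square root of \<open>a\<close>, and the iterated square roots of the latter.\<close>
  define x where "x i = (if i \<le> 1 then im else (rt ^^ (i - 1)) (eval_mpoly (\<lambda>_. im) (Fp2_rep a)))" for i
  have x1: "x 1 = im"
    by (simp add: x_def)
  have "x 2 = rt (eval_mpoly (\<lambda>_. im) (Fp2_rep a))"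
    by (simp add: x_def)
  then have x2: "x 2 ^ 2 = eval_mpoly (\<lambda>_. im) (Fp2_rep a)"
    by (simp only: rt)
  have x3: "x (Suc i) ^ 2 = x i" if "2 \<le> i" for i
  proof -
    obtain m where "i = Suc m"
      using \<open>2 \<le> i\<close> by (cases i) auto
    then show ?thesis
      using \<open>2 \<le> i\<close> by (simp add: x_def rt)
  qed
  have "field_tower (f2 a) l \<and> (\<forall>i\<in>{1..l}. tower_step_degree (f2 a) i 2)" if "1 \<le> l" for l
  proof -
    note tower = conjunct1[OF quadratic_tower_f2[OF a(2-4) x1 x2 x3 that]]
    show ?thesis
      using quadratic_tower.field_tower[OF tower order_refl]
        quadratic_tower.tower_step_degree[OF tower] by auto
  qed
  then show ?thesis
    using a(1) by blast
qed

end
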